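(* Let $p\in(2,6)$ and $\beta=\frac{p-2}{6-p}$. There exists $\varepsilon>0$, depending only on $p$, with the following property. If $\mu>0$ and $\mathcal{G}$ is a metric graph consisting of exactly one half-line attached to a compact core $\mathcal{K}$ satisfying $$\max\Big\{\mu^\beta\,\mathrm{diam}(\mathcal{K}),\ \frac{1}{\mu^\beta|\mathcal{K}|}\Big\}<\varepsilon,$$ then $\mathcal{G}$ has no ground state of mass $\mu$.
   Context: A metric graph $\mathcal{G}$ is a connected graph with finitely many edges, each identified with a bounded interval $[0,\ell_e]$ or a half-line $[0,+\infty)$ (attached at $0$), glued at vertices, with the shortest-path distance. The compact core $\mathcal{K}$ of $\mathcal{G}$ is the metric graph obtained by removing every half-line (as a metric space: removing the interiors of the half-lines). $|\mathcal{K}|$ is the total length of $\mathcal{K}$ (sum of its edge lengths) and $\mathrm{diam}(\mathcal{K})$ its diameter. $H^1(\mathcal{G})$ consists of real continuous functions on $\mathcal{G}$ which are $H^1$ on each edge with finite $H^1$ norm; $E(u,\mathcal{G})=\frac12\int_{\mathcal{G}}|u'|^2-\frac1p\int_{\mathcal{G}}|u|^p$; $H^1_\mu(\mathcal{G})=\{u\in H^1(\mathcal{G}):\|u\|_{L^2}^2=\mu\}$; a ground state of mass $\mu$ is a minimizer of $E(\cdot,\mathcal{G})$ on $H^1_\mu(\mathcal{G})$. *)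

theory Defs
  imports "HOL-Analysis.Analysis"
begin

text \<open>A metric graph with exactly one half-line.  Vertices and bounded edges are
natural numbers.  Each bounded edge e is identified with [0, len e], its point 0
is glued to vertex src e and its point len e to vertex tgt e (loops and multiple
edges allowed).  The unique half-line is identified with [0,+inf) and its point 0
is glued to vertex att.  The compact core K consists of the vertices and the
bounded edges.\<close>

record qgraph =
  verts :: "nat set"
  edges :: "nat set"
  src :: "nat \<Rightarrow> nat"
  tgt :: "nat \<Rightarrow> nat"
  len :: "nat \<Rightarrow> real"
  att :: nat

inductive core_walk :: "qgraph \<Rightarrow> nat \<Rightarrow> nat \<Rightarrow> real \<Rightarrow> bool" for G where
  refl: "core_walk G v v 0"
| step_fw: "core_walk G v u L \<Longrightarrow> e \<in> edges G \<Longrightarrow> src G e = u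
            \<Longrightarrow> core_walk G v (tgt G e) (L + len G e)"
| step_bw: "core_walk G v u L \<Longrightarrow> e \<in> edges G \<Longrightarrow> tgt G e = u
            \<Longrightarrow> core_walk G v (src G e) (L + len G e)"

definition one_halfline_graph :: "qgraph \<Rightarrow> bool" where
  "one_halfline_graph G \<longleftrightarrow>
     finite (verts G) \<and> finite (edges G) \<and> edges G \<noteq> {} \<and>
     (\<forall>e\<in>edges G. src G e \<in> verts G \<and> tgt G e \<in> verts G \<and> len G e > 0) \<and>
     att G \<in> verts G \<and>
     (\<forall>v\<in>verts G. \<forall>w\<in>verts G. \<exists>L. core_walk G v w L)"

definition vdist :: "qgraph \<Rightarrow> nat \<Rightarrow> nat \<Rightarrow> real" where
  "vdist G v w = Inf {L. core_walk G v w L}"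

definition core_points :: "qgraph \<Rightarrow> (nat \<times> real) set" where
  "core_points G = {(e, x). e \<in> edges G \<and> 0 \<le> x \<and> x \<le> len G e}"

text \<open>shortest-path distance between points of K: either stay inside the common
edge, or leave the first edge through an endpoint, travel between vertices, and
enter the second edge through an endpoint\<close>
definition pdist :: "qgraph \<Rightarrow> nat \<times> real \<Rightarrow> nat \<times> real \<Rightarrow> real" where
  "pdist G P Q = (case P of (e, x) \<Rightarrow> case Q of (f, y) \<Rightarrow>
     Min ((if e = f then {\<bar>x - y\<bar>} else {}) \<union>
          {x + vdist G (src G e) (src G f) + y,
           x + vdist G (src G e) (tgt G f) + (len G f - y),
           (len G e - x) + vdist G (tgt G e) (src G f) + y,
           (len G e - x) + vdist G (tgt G e) (tgt G f) + (len G f - y)}))"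

definition core_diam :: "qgraph \<Rightarrow> real" where
  "core_diam G = Sup {pdist G P Q | P Q. P \<in> core_points G \<and> Q \<in> core_points G}"

definition core_length :: "qgraph \<Rightarrow> real" where
  "core_length G = (\<Sum>e\<in>edges G. len G e)"

text \<open>u is H^1 on [0,L] with weak derivative g: g in L^2(0,L) and u is the
(absolutely continuous) primitive of g\<close>
definition H1_interval :: "real \<Rightarrow> (real \<Rightarrow> real) \<Rightarrow> (real \<Rightarrow> real) \<Rightarrow> bool" where
  "H1_interval L u g \<longleftrightarrow>
     set_integrable lborel {0..L} g \<and>
     set_integrable lborel {0..L} (\<lambda>t. (g t)\<^sup>2) \<and>
     (\<forall>x\<in>{0..L}. u x = u 0 + set_lebesgue_integral lborel {0..x} g)"

definition H1_halfline :: "(real \<Rightarrow> real) \<Rightarrow> (real \<Rightarrow> real) \<Rightarrow> bool" where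
  "H1_halfline u g \<longleftrightarrow>
     (\<forall>x\<ge>0. set_integrable lborel {0..x} g) \<and>
     set_integrable lborel {0..} (\<lambda>t. (g t)\<^sup>2) \<and>
     set_integrable lborel {0..} (\<lambda>t. (u t)\<^sup>2) \<and>
     (\<forall>x\<ge>0. u x = u 0 + set_lebesgue_integral lborel {0..x} g)"

text \<open>A function in H^1(G) is given by its restrictions u e to the bounded edges
and w to the half-line, with weak derivatives g e and h; continuity at the
vertices is required.\<close>
definition H1_graph :: "qgraph \<Rightarrow> (nat \<Rightarrow> real \<Rightarrow> real) \<Rightarrow> (real \<Rightarrow> real)
     \<Rightarrow> (nat \<Rightarrow> real \<Rightarrow> real) \<Rightarrow> (real \<Rightarrow> real) \<Rightarrow> bool" where
  "H1_graph G u w g h \<longleftrightarrow>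
     (\<forall>e\<in>edges G. H1_interval (len G e) (u e) (g e)) \<and> H1_halfline w h \<and>
     (\<exists>\<phi> :: nat \<Rightarrow> real.
        (\<forall>e\<in>edges G. u e 0 = \<phi> (src G e) \<and> u e (len G e) = \<phi> (tgt G e)) \<and>
        w 0 = \<phi> (att G))"

definition graph_mass :: "qgraph \<Rightarrow> (nat \<Rightarrow> real \<Rightarrow> real) \<Rightarrow> (real \<Rightarrow> real) \<Rightarrow> real" where
  "graph_mass G u w =
     (\<Sum>e\<in>edges G. set_lebesgue_integral lborel {0..len G e} (\<lambda>t. (u e t)\<^sup>2))
     + set_lebesgue_integral lborel {0..} (\<lambda>t. (w t)\<^sup>2)"

definition graph_energy :: "real \<Rightarrow> qgraph \<Rightarrow> (nat \<Rightarrow> real \<Rightarrow> real) \<Rightarrow> (real \<Rightarrow> real)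
     \<Rightarrow> (nat \<Rightarrow> real \<Rightarrow> real) \<Rightarrow> (real \<Rightarrow> real) \<Rightarrow> real" where
  "graph_energy p G u w g h =
     1/2 * ((\<Sum>e\<in>edges G. set_lebesgue_integral lborel {0..len G e} (\<lambda>t. (g e t)\<^sup>2))
            + set_lebesgue_integral lborel {0..} (\<lambda>t. (h t)\<^sup>2))
   - 1/p * ((\<Sum>e\<in>edges G. set_lebesgue_integral lborel {0..len G e} (\<lambda>t. \<bar>u e t\<bar> powr p))
            + set_lebesgue_integral lborel {0..} (\<lambda>t. \<bar>w t\<bar> powr p))"

definition has_ground_state :: "real \<Rightarrow> qgraph \<Rightarrow> real \<Rightarrow> bool" where
  "has_ground_state p G \<mu> \<longleftrightarrow>
     (\<exists>u w g h. H1_graph G u w g h \<and> graph_mass G u w = \<mu> \<and>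
        (\<forall>v z k l. H1_graph G v z k l \<and> graph_mass G v z = \<mu> \<longrightarrow>
           graph_energy p G u w g h \<le> graph_energy p G v z k l))"

end

theory Submission
  imports Defs
begin

text \<open>The level to beat is - theta * mu powr gamma, where gamma = 2 * beta + 1, the infimum of the energy
over functions on the half-line vanishing at 0: these extend by 0 to the graph, so a ground state
has at most this energy.  Conversely, let Q and T be the mass and the kinetic energy of a ground
state on the core and let s = mu powr beta.  As the core has small diameter and large length,
the boundary value satisfies s * (w 0) ^ 2 <= C * epsilon * (s ^ 2 * Q + T).  Hence cutting the half-line
off and continuing it by a short ramp down to 0 costs less than the amount of order s ^ 2 * Q + T
that is gained by leaving the core; so Q = T = 0, and the ground state is an extremal of the
half-line problem, which does not exist.\<close>

subsection \<open>Functions in H1 of an interval\<close>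

text \<open>Since \<epsilon> may depend on p only, bounds on the core must not see the number or the
  shape of its edges. They are stated through total mass, total kinetic energy, diameter and length.
  The gain from leaving the core is the slope of the level: a half-line carrying \<mu> - Q instead
  of \<mu> loses at least \<theta> * s^2 * Q, because s^2 = \<mu> powr (\<gamma> - 1). The p-term on
  the core gives back at most half of this, since u^2 is small there compared with s * \<mu>, the
  squared height natural at mass \<mu>. This smallness rests on an a priori bound t0 * \<mu> powr
  \<gamma> for the kinetic energy of a ground state, with t0 depending on p only; it follows from a
  nonpositive energy and a Gagliardo-Nirenberg inequality, where p < 6 lets the kinetic term
  dominate. Of the level the argument uses its homogeneity in the mass, \<theta> > 0, and that no
  Dirichlet function of positive mass attains it.\<close>

lemma sq_le_mult_if_AMGM:
  fixes x a b :: real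
  assumes "x \<ge> 0" "a \<ge> 0" "b \<ge> 0" and le: "\<And>l. l > 0 \<Longrightarrow> 2 * x \<le> l * a + b / l"
  shows "x\<^sup>2 \<le> a * b"
proof -
  have *: "2 * x * l \<le> a * l\<^sup>2 + b" if "l > 0" for l
    using le[OF that] that by (simp add: field_simps power2_eq_square)
  \<comment> \<open>The best choice would be l = x / a, which maximises 2 * x * l - a * l^2; the
    added e covers a = 0 and disappears in the limit.\<close>
  have "x\<^sup>2 \<le> (a + e) * b" if "e > 0" for e
  proof (cases "x = 0")
    case False
    then have "x > 0" using assms by simp
    have "2 * x * (x / (a + e)) \<le> a * (x / (a + e))\<^sup>2 + b"
      using \<open>x > 0\<close> assms that by (intro *) auto
    also have "\<dots> \<le> (a + e) * (x / (a + e))\<^sup>2 + b"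
      using that by (simp add: mult_right_mono)
    also have "\<dots> = x\<^sup>2 / (a + e) + b"
      using assms that by (simp add: power_divide power2_eq_square)
    finally have "x\<^sup>2 / (a + e) \<le> b" by (simp add: power2_eq_square)
    then show ?thesis using assms that by (simp add: field_simps)
  qed (use assms that in auto)
  then have "x\<^sup>2 \<le> a * b + e * b" if "e > 0" for e
    using that by (simp add: distrib_right)
  moreover have "((\<lambda>e. a * b + e * b) \<longlongrightarrow> a * b + 0 * b) (at_right 0)"
    by (intro tendsto_intros)
  ultimately have "x\<^sup>2 \<le> a * b + 0 * b"
    by (intro tendsto_lowerbound) (auto simp: eventually_at_right_less eventually_at_filter)
  then show ?thesis by simp
qed

lemma set_integral_nonneg':
  fixes f :: "'a \<Rightarrow> real"
  assumes "\<And>x. x \<in> S \<Longrightarrow> 0 \<le> f x"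
  shows "0 \<le> set_lebesgue_integral M S f"
  unfolding set_lebesgue_integral_def using assms
  by (intro integral_nonneg_AE) (auto simp: indicator_def)

lemma set_integral_mono_set:
  fixes f :: "'a \<Rightarrow> real"
  assumes "set_integrable M B f" "A \<in> sets M" "A \<subseteq> B" "\<And>x. x \<in> B \<Longrightarrow> 0 \<le> f x"
  shows "set_lebesgue_integral M A f \<le> set_lebesgue_integral M B f"
  unfolding set_lebesgue_integral_def
  using assms set_integrable_subset[OF assms(1-3)]
  by (intro integral_mono) (auto simp: set_integrable_def indicator_def)

text \<open>The splitting 2 * |f g| <= l * f^2 + g^2 / l is integrated for each l and then optimised
  by \<open>sq_le_mult_if_AMGM\<close>.\<close>

lemma set_integral_Cauchy_Schwarz:
  fixes f g :: "'a \<Rightarrow> real"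
  assumes "set_integrable M S (\<lambda>t. (f t)\<^sup>2)" "set_integrable M S (\<lambda>t. (g t)\<^sup>2)"
    and fg: "set_integrable M S (\<lambda>t. f t * g t)"
  shows "(set_lebesgue_integral M S (\<lambda>t. \<bar>f t * g t\<bar>))\<^sup>2 \<le>
    set_lebesgue_integral M S (\<lambda>t. (f t)\<^sup>2) * set_lebesgue_integral M S (\<lambda>t. (g t)\<^sup>2)"
proof (rule sq_le_mult_if_AMGM)
  fix l :: real assume "l > 0"
  have "2 * set_lebesgue_integral M S (\<lambda>t. \<bar>f t * g t\<bar>) = set_lebesgue_integral M S (\<lambda>t. 2 * \<bar>f t * g t\<bar>)"
    by simp
  also have "\<dots> \<le> set_lebesgue_integral M S (\<lambda>t. l * (f t)\<^sup>2 + (g t)\<^sup>2 / l)"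
  proof (intro set_integral_mono set_integrable_mult_right set_integral_add set_integrable_divide assms set_integrable_abs[OF fg])
    fix t
    have "0 \<le> (l * \<bar>f t\<bar> - \<bar>g t\<bar>)\<^sup>2" by simp
    also have "\<dots> = l * (l * (f t)\<^sup>2 + (g t)\<^sup>2 / l - 2 * \<bar>f t * g t\<bar>)"
      using \<open>l > 0\<close> by (simp add: field_simps power2_eq_square abs_mult)
    finally show "2 * \<bar>f t * g t\<bar> \<le> l * (f t)\<^sup>2 + (g t)\<^sup>2 / l"
      using \<open>l > 0\<close> by (simp add: zero_le_mult_iff)
  qed
  also have "\<dots> = l * set_lebesgue_integral M S (\<lambda>t. (f t)\<^sup>2) + set_lebesgue_integral M S (\<lambda>t. (g t)\<^sup>2) / l"
    using assms by (subst set_integral_add) (auto intro!: set_integrable_mult_right set_integrable_divide)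
  finally show "2 * set_lebesgue_integral M S (\<lambda>t. \<bar>f t * g t\<bar>) \<le> \<dots>" .
qed (rule set_integral_nonneg', simp)+

lemma H1_interval_D:
  assumes "H1_interval L u g"
  shows "set_integrable lborel {0..L} g" "set_integrable lborel {0..L} (\<lambda>t. (g t)\<^sup>2)"
    "\<And>x. 0 \<le> x \<Longrightarrow> x \<le> L \<Longrightarrow> u x = u 0 + set_lebesgue_integral lborel {0..x} g"
  using assms unfolding H1_interval_def by (blast, blast, meson atLeastAtMost_iff)

lemma H1_halfline_D:
  assumes "H1_halfline u g"
  shows "\<And>x. 0 \<le> x \<Longrightarrow> set_integrable lborel {0..x} g" "set_integrable lborel {0..} (\<lambda>t. (g t)\<^sup>2)"
    "set_integrable lborel {0..} (\<lambda>t. (u t)\<^sup>2)"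
    "\<And>x. 0 \<le> x \<Longrightarrow> u x = u 0 + set_lebesgue_integral lborel {0..x} g"
  using assms unfolding H1_halfline_def by blast+

lemma H1_halfline_restrict:
  assumes "H1_halfline u g" "0 \<le> L"
  shows "H1_interval L u g"
  unfolding H1_interval_def
proof (intro conjI ballI)
  show "set_integrable lborel {0..L} g"
    by (rule H1_halfline_D(1)[OF assms])
  show "set_integrable lborel {0..L} (\<lambda>t. (g t)\<^sup>2)"
    by (rule set_integrable_subset[OF H1_halfline_D(2)[OF assms(1)]]) auto
  show "u x = u 0 + set_lebesgue_integral lborel {0..x} g" if "x \<in> {0..L}" for x
    using that by (intro H1_halfline_D(4)[OF assms(1)]) auto
qed

lemma lborel_set_integral_Icc_split:
  fixes g :: "real \<Rightarrow> real"
  assumes "a \<le> b" "b \<le> c" "set_integrable lborel {a..c} g"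
  shows "set_lebesgue_integral lborel {a..c} g =
    set_lebesgue_integral lborel {a..b} g + set_lebesgue_integral lborel {b..c} g"
proof -
  have "{a..c} = {a..b} \<union> {b..c}" using assms by auto
  moreover have "AE x in lborel. \<not> (x \<in> {a..b} \<and> x \<in> {b..c})"
    using AE_lborel_singleton[of b] by eventually_elim auto
  ultimately show ?thesis using assms
    by (simp add: set_integral_Un_AE set_integrable_subset[OF assms(3)])
qed

context
  fixes L :: real and u g :: "real \<Rightarrow> real"
  assumes H1: "H1_interval L u g"
begin

lemma H1_interval_diff:
  assumes "0 \<le> x" "x \<le> y" "y \<le> L"
  shows "u y - u x = set_lebesgue_integral lborel {x..y} g"
  using lborel_set_integral_Icc_split[of 0 x y g] assms H1_interval_D(3)[OF H1, of x]
    H1_interval_D(3)[OF H1, of y] set_integrable_subset[OF H1_interval_D(1)[OF H1], of "{0..y}"]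
  by auto

lemma H1_interval_continuous: "continuous_on {0..L} u"
proof -
  have "continuous_on {0..L} (\<lambda>x. u 0 + integral {0..x} g)"
    using set_borel_integral_eq_integral(1)[OF H1_interval_D(1)[OF H1]]
    by (intro continuous_intros indefinite_integral_continuous_1)
  also have "?this \<longleftrightarrow> ?thesis"
  proof (rule continuous_on_cong[OF HOL.refl])
    fix x assume x: "x \<in> {0..L}"
    then have "set_integrable lborel {0..x} g"
      by (intro set_integrable_subset[OF H1_interval_D(1)[OF H1]]) auto
    then show "u 0 + integral {0..x} g = u x"
      using H1_interval_D(3)[OF H1, of x] x by (simp add: set_borel_integral_eq_integral)
  qed
  finally show ?thesis .
qed

lemma H1_interval_set_integrable_continuous_mult:
  assumes "continuous_on {0..L} v"
  shows "set_integrable lborel {0..L} (\<lambda>t. v t * g t)"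
proof -
  have "bounded (v ` {0..L})" using assms compact_continuous_image compact_imp_bounded by blast
  then obtain B where B: "\<And>t. t \<in> {0..L} \<Longrightarrow> \<bar>v t\<bar> \<le> B"
    unfolding bounded_iff by (metis imageI real_norm_def)
  have 1: "set_integrable lborel {0..L} (\<lambda>t. B * g t)"
    using H1_interval_D(1)[OF H1] by simp
  have "set_borel_measurable borel {0..L} v"
    using assms by (intro set_measurable_continuous_on) auto
  moreover have "set_borel_measurable lborel {0..L} g"
    using H1_interval_D(1)[OF H1] unfolding set_integrable_def set_borel_measurable_def
    by (rule borel_measurable_integrable)
  ultimately have "(\<lambda>t. (indicator {0..L} t *\<^sub>R v t) * (indicator {0..L} t *\<^sub>R g t)) \<in> borel_measurable lborel"
    unfolding set_borel_measurable_def by (intro borel_measurable_times) auto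
  also have "(\<lambda>t. (indicator {0..L} t *\<^sub>R v t) * (indicator {0..L} t *\<^sub>R g t)) = (\<lambda>t. indicator {0..L} t *\<^sub>R (v t * g t))"
    by (auto simp: indicator_def)
  finally have 2: "set_borel_measurable lborel {0..L} (\<lambda>t. v t * g t)"
    by (simp add: set_borel_measurable_def)
  show ?thesis
  proof (rule set_integrable_bound[OF 1 2], intro AE_I2 impI)
    fix t assume "t \<in> {0..L}"
    then have "\<bar>v t\<bar> * \<bar>g t\<bar> \<le> \<bar>B\<bar> * \<bar>g t\<bar>" using B by (intro mult_right_mono) force+
    then show "norm (v t * g t) \<le> norm (B * g t)" by (simp add: abs_mult)
  qed
qed

text \<open>Cauchy-Schwarz against the constant 1: the Hoelder-1/2 bound for H1 functions.\<close>

lemma H1_interval_diff_sq_le: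
  assumes "0 \<le> x" "x \<le> y" "y \<le> L"
  shows "(u y - u x)\<^sup>2 \<le> (y - x) * set_lebesgue_integral lborel {x..y} (\<lambda>t. (g t)\<^sup>2)"
proof -
  have sub: "set_integrable lborel {x..y} g" "set_integrable lborel {x..y} (\<lambda>t. (g t)\<^sup>2)"
    using assms set_integrable_subset[OF H1_interval_D(1)[OF H1], of "{x..y}"]
      set_integrable_subset[OF H1_interval_D(2)[OF H1], of "{x..y}"] by auto
  have "\<bar>u y - u x\<bar> \<le> set_lebesgue_integral lborel {x..y} (\<lambda>t. \<bar>1 * g t\<bar>)"
    using set_integral_norm_bound[OF sub(1)] H1_interval_diff[OF assms] by simp
  then have "(u y - u x)\<^sup>2 \<le> (set_lebesgue_integral lborel {x..y} (\<lambda>t. \<bar>1 * g t\<bar>))\<^sup>2"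
    by (metis abs_ge_zero power2_abs power_mono)
  also have "\<dots> \<le> set_lebesgue_integral lborel {x..y} (\<lambda>t. 1\<^sup>2) * set_lebesgue_integral lborel {x..y} (\<lambda>t. (g t)\<^sup>2)"
    using sub by (intro set_integral_Cauchy_Schwarz) (auto intro: borel_integrable_atLeastAtMost')
  also have "set_lebesgue_integral lborel {x..y} (\<lambda>t. 1\<^sup>2) = y - x"
    using assms by (simp add: set_lebesgue_integral_def)
  finally show ?thesis .
qed

text \<open>Replaces the product rule for absolutely continuous functions: near a point the estimate holds
  up to an error proportional to the variation, and Bolzano's bisection makes it global.\<close>
lemma H1_interval_diff_squares_le:
  assumes xy: "0 \<le> x" "x \<le> y" "y \<le> L"
  shows "\<bar>(u y)\<^sup>2 - (u x)\<^sup>2\<bar> \<le> 2 * set_lebesgue_integral lborel {x..y} (\<lambda>t. \<bar>u t * g t\<bar>)"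
proof -
  define N where "N = set_lebesgue_integral lborel {x..y} (\<lambda>t. \<bar>g t\<bar>)"
  have N0: "N \<ge> 0" unfolding N_def by (intro set_integral_nonneg') auto
  have Ig: "set_integrable lborel {0..L} (\<lambda>t. \<bar>g t\<bar>)"
    using set_integrable_abs[OF H1_interval_D(1)[OF H1]] .
  have Iug: "set_integrable lborel {0..L} (\<lambda>t. \<bar>u t * g t\<bar>)"
    using set_integrable_abs[OF H1_interval_set_integrable_continuous_mult[OF H1_interval_continuous]] .
  have key: "\<bar>(u y)\<^sup>2 - (u x)\<^sup>2\<bar> \<le> set_lebesgue_integral lborel {x..y} (\<lambda>t. 2 * \<bar>u t * g t\<bar> + e * \<bar>g t\<bar>)"
    if e: "e > 0" for e
  proof -
    let ?h = "\<lambda>t. 2 * \<bar>u t * g t\<bar> + e * \<bar>g t\<bar>"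
    have Ih: "set_integrable lborel {0..L} ?h"
      using Ig Iug by (intro set_integral_add set_integrable_mult_right)
    have "x \<le> x \<and> y \<le> y \<longrightarrow> \<bar>(u y)\<^sup>2 - (u x)\<^sup>2\<bar> \<le> set_lebesgue_integral lborel {x..y} ?h"
    proof (rule Bolzano[of x y "\<lambda>a b. x \<le> a \<and> b \<le> y \<longrightarrow> \<bar>(u b)\<^sup>2 - (u a)\<^sup>2\<bar> \<le> set_lebesgue_integral lborel {a..b} ?h"])
      fix a b c
      assume ab: "x \<le> a \<and> b \<le> y \<longrightarrow> \<bar>(u b)\<^sup>2 - (u a)\<^sup>2\<bar> \<le> set_lebesgue_integral lborel {a..b} ?h"
        and bc: "x \<le> b \<and> c \<le> y \<longrightarrow> \<bar>(u c)\<^sup>2 - (u b)\<^sup>2\<bar> \<le> set_lebesgue_integral lborel {b..c} ?h"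
        and le: "a \<le> b" "b \<le> c"
      show "x \<le> a \<and> c \<le> y \<longrightarrow> \<bar>(u c)\<^sup>2 - (u a)\<^sup>2\<bar> \<le> set_lebesgue_integral lborel {a..c} ?h"
      proof
        assume "x \<le> a \<and> c \<le> y"
        moreover from this have "set_integrable lborel {a..c} ?h"
          using xy by (intro set_integrable_subset[OF Ih]) auto
        ultimately show "\<bar>(u c)\<^sup>2 - (u a)\<^sup>2\<bar> \<le> set_lebesgue_integral lborel {a..c} ?h"
          using ab bc le lborel_set_integral_Icc_split[of a b c ?h] by auto
      qed
    next
      fix z assume z: "x \<le> z" "z \<le> y"
      \<comment> \<open>With e / 4, any two values of u on [a, b] differ by less than e / 2, so |u b
        + u a| exceeds 2 * |u t| by at most e for every t in between.\<close>
      have "\<exists>d>0. \<forall>t\<in>{0..L}. dist t z < d \<longrightarrow> dist (u t) (u z) < e / 4"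
        using H1_interval_continuous[unfolded continuous_on_iff, rule_format, of z "e / 4"] z xy e
        by (simp del: dist_real_def)
      then obtain d where d: "d > 0" "\<And>t. t \<in> {0..L} \<Longrightarrow> \<bar>t - z\<bar> < d \<Longrightarrow> \<bar>u t - u z\<bar> < e / 4"
        by (auto simp: dist_real_def)
      show "\<exists>d>0. \<forall>a b. a \<le> z \<and> z \<le> b \<and> b - a < d \<longrightarrow>
          x \<le> a \<and> b \<le> y \<longrightarrow> \<bar>(u b)\<^sup>2 - (u a)\<^sup>2\<bar> \<le> set_lebesgue_integral lborel {a..b} ?h"
      proof (intro exI[of _ d] conjI allI impI d(1))
        fix a b assume A: "a \<le> z \<and> z \<le> b \<and> b - a < d" "x \<le> a \<and> b \<le> y"
        have I: "set_integrable lborel {a..b} ?h" "set_integrable lborel {a..b} g"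
          using A xy by (auto intro!: set_integrable_subset[OF Ih] set_integrable_subset[OF H1_interval_D(1)[OF H1]])
        have "\<bar>(u b)\<^sup>2 - (u a)\<^sup>2\<bar> = \<bar>u b + u a\<bar> * \<bar>u b - u a\<bar>"
          by (simp add: power2_eq_square abs_mult[symmetric] algebra_simps)
        also have "\<dots> \<le> \<bar>u b + u a\<bar> * set_lebesgue_integral lborel {a..b} (\<lambda>t. \<bar>g t\<bar>)"
          using H1_interval_diff[of a b] A xy set_integral_norm_bound[OF I(2)]
          by (intro mult_left_mono) auto
        also have "\<dots> = set_lebesgue_integral lborel {a..b} (\<lambda>t. \<bar>u b + u a\<bar> * \<bar>g t\<bar>)" by simp
        also have "\<dots> \<le> set_lebesgue_integral lborel {a..b} ?h"
        proof (intro set_integral_mono set_integrable_mult_right I set_integrable_abs)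
          fix t assume t: "t \<in> {a..b}"
          have "\<bar>u t - u z\<bar> < e / 4" "\<bar>u a - u z\<bar> < e / 4" "\<bar>u b - u z\<bar> < e / 4"
            using t A xy z by - (rule d(2); auto)+
          then have "\<bar>u b + u a\<bar> \<le> 2 * \<bar>u t\<bar> + e" by linarith
          then have "\<bar>u b + u a\<bar> * \<bar>g t\<bar> \<le> (2 * \<bar>u t\<bar> + e) * \<bar>g t\<bar>" by (intro mult_right_mono) auto
          then show "\<bar>u b + u a\<bar> * \<bar>g t\<bar> \<le> ?h t" by (simp add: algebra_simps abs_mult)
        qed
        finally show "\<bar>(u b)\<^sup>2 - (u a)\<^sup>2\<bar> \<le> set_lebesgue_integral lborel {a..b} ?h" .
      qed
    qed (use xy in auto)
    then show ?thesis by simp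
  qed
  have sub: "set_integrable lborel {x..y} (\<lambda>t. \<bar>g t\<bar>)" "set_integrable lborel {x..y} (\<lambda>t. \<bar>u t * g t\<bar>)"
    using xy by (auto intro!: set_integrable_subset[OF Ig] set_integrable_subset[OF Iug])
  have "\<bar>(u y)\<^sup>2 - (u x)\<^sup>2\<bar> \<le> 2 * set_lebesgue_integral lborel {x..y} (\<lambda>t. \<bar>u t * g t\<bar>) + e * N"
    if "e > 0" for e
    using key[OF that] sub unfolding N_def by (subst (asm) set_integral_add) auto
  moreover have "((\<lambda>e. 2 * set_lebesgue_integral lborel {x..y} (\<lambda>t. \<bar>u t * g t\<bar>) + e * N) \<longlongrightarrow>
     2 * set_lebesgue_integral lborel {x..y} (\<lambda>t. \<bar>u t * g t\<bar>) + 0 * N) (at_right 0)"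
    by (intro tendsto_intros)
  ultimately have "\<bar>(u y)\<^sup>2 - (u x)\<^sup>2\<bar> \<le> 2 * set_lebesgue_integral lborel {x..y} (\<lambda>t. \<bar>u t * g t\<bar>) + 0 * N"
    by (intro tendsto_lowerbound[rotated]) (auto simp: eventually_at_filter)
  then show ?thesis by simp
qed

end

subsection \<open>Walks and distances in the core\<close>

lemma core_walk_trans:
  assumes "core_walk G v w L'" "core_walk G u v L"
  shows "core_walk G u w (L + L')"
  using assms
proof (induction rule: core_walk.induct)
  case (step_fw v u L' e)
  then show ?case using core_walk.step_fw[of G _ u "L + L'" e] by (simp add: algebra_simps)
next
  case (step_bw v u L' e)
  then show ?case using core_walk.step_bw[of G _ u "L + L'" e] by (simp add: algebra_simps)
qed simp

lemma core_walk_edge_fw: "e \<in> edges G \<Longrightarrow> core_walk G (src G e) (tgt G e) (len G e)"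
  using core_walk.step_fw[OF core_walk.refl, of e G] by simp

lemma core_walk_edge_bw: "e \<in> edges G \<Longrightarrow> core_walk G (tgt G e) (src G e) (len G e)"
  using core_walk.step_bw[OF core_walk.refl, of e G] by simp

text \<open>A walk may repeat edges; covering the segment between the end values by the segments of its
  edges counts every edge only once, without extracting a simple path.\<close>
lemma core_walk_closed_segment_subset:
  assumes "core_walk G v w L" "\<And>e. e \<in> edges G \<Longrightarrow> 0 \<le> len G e" "finite (edges G)"
  shows "\<exists>S\<subseteq>edges G. sum (len G) S \<le> L \<and>
    (\<forall>\<phi>::nat \<Rightarrow> real. closed_segment (\<phi> v) (\<phi> w) \<subseteq> {\<phi> v} \<union> (\<Union>e\<in>S. closed_segment (\<phi> (src G e)) (\<phi> (tgt G e))))"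
  using assms(1)
proof (induction rule: core_walk.induct)
  case (refl v)
  show ?case by (intro exI[of _ "{}"]) auto
next
  case (step_fw v u L e)
  then obtain S where S: "S \<subseteq> edges G" "sum (len G) S \<le> L"
    "\<And>\<phi>::nat \<Rightarrow> real. closed_segment (\<phi> v) (\<phi> u) \<subseteq> {\<phi> v} \<union> (\<Union>e\<in>S. closed_segment (\<phi> (src G e)) (\<phi> (tgt G e)))"
    by blast
  have seg: "closed_segment (\<phi> v) (\<phi> (tgt G e)) \<subseteq> closed_segment (\<phi> v) (\<phi> u) \<union> closed_segment (\<phi> (src G e)) (\<phi> (tgt G e))"
    for \<phi> :: "nat \<Rightarrow> real"
    using step_fw by (auto simp: closed_segment_eq_real_ivl split: if_splits)
  have sum: "sum (len G) (insert e S) \<le> L + len G e"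
    using S(2) assms(2)[OF step_fw(2)] finite_subset[OF S(1) assms(3)] by (simp add: sum.insert_if)
  show ?case
  proof (intro exI[of _ "insert e S"] conjI allI sum)
    show "insert e S \<subseteq> edges G" using S(1) step_fw(2) by blast
    show "closed_segment (\<phi> v) (\<phi> (tgt G e)) \<subseteq>
        {\<phi> v} \<union> (\<Union>e\<in>insert e S. closed_segment (\<phi> (src G e)) (\<phi> (tgt G e)))" for \<phi> :: "nat \<Rightarrow> real"
      using seg[of \<phi>] S(3)[of \<phi>] by auto
  qed
next
  case (step_bw v u L e)
  then obtain S where S: "S \<subseteq> edges G" "sum (len G) S \<le> L"
    "\<And>\<phi>::nat \<Rightarrow> real. closed_segment (\<phi> v) (\<phi> u) \<subseteq> {\<phi> v} \<union> (\<Union>e\<in>S. closed_segment (\<phi> (src G e)) (\<phi> (tgt G e)))"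
    by blast
  have seg: "closed_segment (\<phi> v) (\<phi> (src G e)) \<subseteq> closed_segment (\<phi> v) (\<phi> u) \<union> closed_segment (\<phi> (src G e)) (\<phi> (tgt G e))"
    for \<phi> :: "nat \<Rightarrow> real"
    using step_bw by (auto simp: closed_segment_eq_real_ivl split: if_splits)
  have sum: "sum (len G) (insert e S) \<le> L + len G e"
    using S(2) assms(2)[OF step_bw(2)] finite_subset[OF S(1) assms(3)] by (simp add: sum.insert_if)
  show ?case
  proof (intro exI[of _ "insert e S"] conjI allI sum)
    show "insert e S \<subseteq> edges G" using S(1) step_bw(2) by blast
    show "closed_segment (\<phi> v) (\<phi> (src G e)) \<subseteq>
        {\<phi> v} \<union> (\<Union>e\<in>insert e S. closed_segment (\<phi> (src G e)) (\<phi> (tgt G e)))" for \<phi> :: "nat \<Rightarrow> real"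
      using seg[of \<phi>] S(3)[of \<phi>] by auto
  qed
qed

lemma core_walk_diff_le:
  assumes "core_walk G v w L" "\<And>e. e \<in> edges G \<Longrightarrow> 0 \<le> len G e" "finite (edges G)"
  obtains S where "S \<subseteq> edges G" "sum (len G) S \<le> L"
    "\<And>\<phi>::nat \<Rightarrow> real. \<bar>\<phi> w - \<phi> v\<bar> \<le> (\<Sum>e\<in>S. \<bar>\<phi> (tgt G e) - \<phi> (src G e)\<bar>)"
proof -
  obtain S where S: "S \<subseteq> edges G" "sum (len G) S \<le> L"
    "\<And>\<phi>::nat \<Rightarrow> real. closed_segment (\<phi> v) (\<phi> w) \<subseteq> {\<phi> v} \<union> (\<Union>e\<in>S. closed_segment (\<phi> (src G e)) (\<phi> (tgt G e)))"
    using core_walk_closed_segment_subset[OF assms] by blast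
  have fin: "finite S" using S(1) assms(3) finite_subset by blast
  have seg: "measure lborel (closed_segment a b) = \<bar>b - a\<bar>" "closed_segment a b \<in> fmeasurable lborel" for a b :: real
    by (auto simp: closed_segment_eq_real_ivl fmeasurable_def)
  have "\<bar>\<phi> w - \<phi> v\<bar> \<le> (\<Sum>e\<in>S. \<bar>\<phi> (tgt G e) - \<phi> (src G e)\<bar>)" for \<phi> :: "nat \<Rightarrow> real"
  proof -
    let ?I = "\<lambda>e. closed_segment (\<phi> (src G e)) (\<phi> (tgt G e))"
    have U: "(\<Union>e\<in>S. ?I e) \<in> fmeasurable lborel"
      using fin seg(2) by (intro fmeasurable.finite_UN) auto
    have sing: "{\<phi> v} \<in> fmeasurable lborel" by (auto simp: fmeasurable_def)
    have "\<bar>\<phi> w - \<phi> v\<bar> = measure lborel (closed_segment (\<phi> v) (\<phi> w))"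
      using seg by simp
    also have "\<dots> \<le> measure lborel ({\<phi> v} \<union> (\<Union>e\<in>S. ?I e))"
      using S(3)[of \<phi>] seg(2) fmeasurable.Un[OF sing U] by (intro measure_mono_fmeasurable) auto
    also have "\<dots> \<le> measure lborel {\<phi> v} + measure lborel (\<Union>e\<in>S. ?I e)"
      using U sing by (intro measure_Un_le) auto
    also have "\<dots> \<le> 0 + (\<Sum>e\<in>S. measure lborel (?I e))"
      using fin seg(2) by (intro add_mono measure_UNION_le) auto
    finally show ?thesis by (simp add: seg)
  qed
  then show ?thesis using that S by blast
qed

locale one_halfline =
  fixes G :: qgraph
  assumes one_halfline_graph: "one_halfline_graph G"
begin

lemma finite_edges: "finite (edges G)" and edges_nonempty: "edges G \<noteq> {}"
  and finite_verts: "finite (verts G)" and att_in_verts: "att G \<in> verts G"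
  and src_in_verts: "\<And>e. e \<in> edges G \<Longrightarrow> src G e \<in> verts G"
  and tgt_in_verts: "\<And>e. e \<in> edges G \<Longrightarrow> tgt G e \<in> verts G"
  and len_pos: "\<And>e. e \<in> edges G \<Longrightarrow> 0 < len G e"
  and connected: "\<And>v w. v \<in> verts G \<Longrightarrow> w \<in> verts G \<Longrightarrow> \<exists>L. core_walk G v w L"
  using one_halfline_graph unfolding one_halfline_graph_def by auto

lemma core_walk_nonneg: "core_walk G v w L \<Longrightarrow> 0 \<le> L"
  by (induction rule: core_walk.induct) (auto dest!: len_pos)

lemma vdist_nonneg: "v \<in> verts G \<Longrightarrow> w \<in> verts G \<Longrightarrow> 0 \<le> vdist G v w"
  unfolding vdist_def using connected[of v w]
  by (intro cInf_greatest) (auto intro: core_walk_nonneg)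

lemma vdist_approx:
  assumes "v \<in> verts G" "w \<in> verts G" "vdist G v w < c"
  shows "\<exists>L<c. core_walk G v w L"
proof -
  have "\<exists>L\<in>{L. core_walk G v w L}. L < c"
    using assms connected[of v w] core_walk_nonneg unfolding vdist_def
    by (subst (asm) cInf_less_iff) (auto intro!: bdd_belowI)
  then show ?thesis by auto
qed

text \<open>A crude bound whose purpose is that the supremum in \<open>core_diam\<close> is over a
  set bounded above, and hence dominates every \<open>pdist\<close>.\<close>

lemma pdist_le_sum:
  assumes "P \<in> core_points G" "Q \<in> core_points G"
  shows "pdist G P Q \<le> 2 * (\<Sum>e\<in>edges G. len G e) + (\<Sum>v\<in>verts G. \<Sum>w\<in>verts G. vdist G v w)"
proof -
  obtain e x f y where PQ: "P = (e, x)" "Q = (f, y)" by fastforce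
  have ef: "e \<in> edges G" "f \<in> edges G" "0 \<le> x" "0 \<le> y" "x \<le> len G e" "y \<le> len G f"
    using assms by (auto simp: PQ core_points_def)
  have l: "len G e \<le> (\<Sum>e\<in>edges G. len G e)" if "e \<in> edges G" for e
    using that len_pos finite_edges by (intro member_le_sum) (auto intro: less_imp_le)
  have "pdist G P Q \<le> x + vdist G (src G e) (src G f) + y"
    unfolding pdist_def PQ prod.case by (rule Min_le) auto
  also have "vdist G (src G e) (src G f) \<le> (\<Sum>w\<in>verts G. vdist G (src G e) w)"
    using ef by (intro member_le_sum) (auto intro: vdist_nonneg simp: finite_verts src_in_verts)
  also have "\<dots> \<le> (\<Sum>v\<in>verts G. \<Sum>w\<in>verts G. vdist G v w)"
    using ef by (intro member_le_sum[of "src G e" "verts G" "\<lambda>v. \<Sum>w\<in>verts G. vdist G v w"])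
      (auto intro!: sum_nonneg vdist_nonneg simp: finite_verts src_in_verts)
  finally show ?thesis using l[OF ef(1)] l[OF ef(2)] ef by linarith
qed

lemma pdist_le_core_diam:
  assumes "P \<in> core_points G" "Q \<in> core_points G"
  shows "pdist G P Q \<le> core_diam G"
  unfolding core_diam_def
proof (rule cSup_upper)
  show "bdd_above {pdist G P Q |P Q. P \<in> core_points G \<and> Q \<in> core_points G}"
    using pdist_le_sum by (intro bdd_aboveI) blast
qed (use assms in blast)

text \<open>Every route from an end of an edge to its midpoint costs at least half the edge. The
  factor 2 is sharp when the core is a single loop.\<close>

lemma len_le_core_diam:
  assumes "e \<in> edges G"
  shows "len G e \<le> 2 * core_diam G"
proof -
  have "len G e / 2 \<le> pdist G (e, 0) (e, len G e / 2)"
    unfolding pdist_def prod.case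
    using len_pos[OF assms] vdist_nonneg[OF src_in_verts[OF assms] src_in_verts[OF assms]]
     vdist_nonneg[OF src_in_verts[OF assms] tgt_in_verts[OF assms]]
     vdist_nonneg[OF tgt_in_verts[OF assms] src_in_verts[OF assms]]
     vdist_nonneg[OF tgt_in_verts[OF assms] tgt_in_verts[OF assms]]
    by (subst Min_ge_iff) auto
  also have "\<dots> \<le> core_diam G"
    using assms len_pos[OF assms] by (intro pdist_le_core_diam) (auto simp: core_points_def)
  finally show ?thesis by simp
qed

lemma core_diam_pos: "0 < core_diam G"
  using edges_nonempty len_le_core_diam len_pos by fastforce

text \<open>Points of the core are pairs of an edge and a coordinate, so a vertex enters
  \<open>pdist\<close> only as an end of some edge; this relates a vertex to such a pair.\<close>

definition at_end :: "nat \<Rightarrow> nat \<Rightarrow> real \<Rightarrow> bool" where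
  "at_end v e x \<longleftrightarrow> e \<in> edges G \<and> (x = 0 \<and> v = src G e \<or> x = len G e \<and> v = tgt G e)"

lemma at_end_walks:
  assumes "at_end v e x"
  shows "core_walk G v (src G e) x" "core_walk G v (tgt G e) (len G e - x)"
    "core_walk G (src G e) v x" "core_walk G (tgt G e) v (len G e - x)"
    "0 \<le> x" "x \<le> len G e" "e \<in> edges G"
  using assms core_walk.refl core_walk_edge_fw[of e G] core_walk_edge_bw[of e G] len_pos[of e]
  by (auto simp: at_end_def)

lemma walk_via:
  assumes "a \<in> verts G" "b \<in> verts G" "core_walk G v a x" "core_walk G b w y" "x + vdist G a b + y < c"
  shows "\<exists>L<c. core_walk G v w L"
proof -
  obtain L where L: "L < c - x - y" "core_walk G a b L"
    using vdist_approx[of a b "c - x - y"] assms by auto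
  have "core_walk G v w (x + (L + y))"
    using L assms core_walk_trans by blast
  then show ?thesis using L by (intro exI[of _ "x + (L + y)"]) auto
qed

text \<open>Each candidate in the minimum defining \<open>pdist\<close> becomes a walk. For a common
  edge this works because both points are ends, so |x - y| is either 0 or the full length.\<close>

lemma at_end_walk_lt:
  assumes v: "at_end v e x" and w: "at_end w f y" and lt: "pdist G (e, x) (f, y) < c"
  shows "\<exists>L<c. core_walk G v w L"
proof -
  note V = at_end_walks[OF v] and W = at_end_walks[OF w]
  note verts = src_in_verts[OF V(7)] src_in_verts[OF W(7)] tgt_in_verts[OF V(7)] tgt_in_verts[OF W(7)]
  have "(e = f \<and> \<bar>x - y\<bar> < c) \<or> x + vdist G (src G e) (src G f) + y < c \<or>
     x + vdist G (src G e) (tgt G f) + (len G f - y) < c \<or>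
     (len G e - x) + vdist G (tgt G e) (src G f) + y < c \<or>
     (len G e - x) + vdist G (tgt G e) (tgt G f) + (len G f - y) < c"
    using lt unfolding pdist_def prod.case by (subst (asm) Min_less_iff) (auto split: if_splits)
  then show ?thesis
  proof (elim disjE)
    assume ef: "e = f \<and> \<bar>x - y\<bar> < c"
    have "core_walk G v w \<bar>x - y\<bar>"
      using v w ef core_walk.refl core_walk_edge_fw[of e G] core_walk_edge_bw[of e G] len_pos[OF V(7)]
      by (auto simp: at_end_def)
    then show ?thesis using ef by blast
  qed (use V W verts walk_via in blast)+
qed

text \<open>A walk arriving at \<open>att G\<close> from an edge is either trivial or has a last
  edge, and that edge has \<open>att G\<close> as an end.\<close>

lemma att_at_end: "\<exists>e x. at_end (att G) e x"
proof -
  obtain e where e: "e \<in> edges G" using edges_nonempty by blast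
  obtain L where "core_walk G (src G e) (att G) L"
    using connected[OF src_in_verts[OF e] att_in_verts] by blast
  then show ?thesis
    by cases (use e in \<open>auto simp: at_end_def\<close>)
qed

text \<open>\<open>vdist\<close> is an infimum, so walks are obtained only for lengths strictly
  above it; as the diameter is positive, doubling it leaves the necessary room.\<close>

lemma walk_to_src:
  assumes "e \<in> edges G"
  shows "\<exists>L\<le>2 * core_diam G. core_walk G (att G) (src G e) L"
proof -
  obtain f y where f: "at_end (att G) f y" using att_at_end by blast
  have e: "at_end (src G e) e 0" using assms by (simp add: at_end_def)
  have "pdist G (f, y) (e, 0) \<le> core_diam G"
    using at_end_walks[OF f] at_end_walks[OF e] by (intro pdist_le_core_diam) (auto simp: core_points_def)
  then obtain L where "L < 2 * core_diam G" "core_walk G (att G) (src G e) L"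
    using at_end_walk_lt[OF f e, of "2 * core_diam G"] core_diam_pos by auto
  then show ?thesis by (intro exI[of _ L]) auto
qed

end

subsection \<open>Functions on the core\<close>

lemma abs_powr_le_powr_mult_sq:
  fixes x :: real
  assumes "x\<^sup>2 \<le> B" "2 < p"
  shows "\<bar>x\<bar> powr p \<le> B powr ((p - 2) / 2) * x\<^sup>2"
proof (cases "x = 0")
  case False
  have "\<bar>x\<bar> powr p = \<bar>x\<bar> powr (p - 2) * \<bar>x\<bar> powr 2"
    unfolding powr_add[symmetric] by simp
  also have "\<bar>x\<bar> powr 2 = x\<^sup>2" using False by simp
  also have "\<bar>x\<bar> powr (p - 2) = (\<bar>x\<bar> powr 2) powr ((p - 2) / 2)"
    unfolding powr_powr by (rule arg_cong[of _ _ "(powr) \<bar>x\<bar>"]) simp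
  also have "\<bar>x\<bar> powr 2 = x\<^sup>2" using False by simp
  also have "(x\<^sup>2) powr ((p - 2) / 2) * x\<^sup>2 \<le> B powr ((p - 2) / 2) * x\<^sup>2"
    using assms by (intro mult_right_mono powr_mono2) auto
  finally show ?thesis .
qed simp

lemma H1_interval_integrable_square:
  assumes "H1_interval L u g"
  shows "set_integrable lborel {0..L} (\<lambda>t. (u t)\<^sup>2)"
  using H1_interval_continuous[OF assms]
  by (intro borel_integrable_atLeastAtMost' continuous_intros)

lemma H1_interval_integrable_powr:
  assumes "H1_interval L u g" "0 < p"
  shows "set_integrable lborel {0..L} (\<lambda>t. \<bar>u t\<bar> powr p)"
  using H1_interval_continuous[OF assms(1)] assms(2)
  by (intro borel_integrable_atLeastAtMost' continuous_intros continuous_on_powr') auto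

lemma H1_interval_abs_mult_integral_le:
  assumes "H1_interval L u g"
  shows "set_lebesgue_integral lborel {0..L} (\<lambda>t. \<bar>u t * g t\<bar>) \<le>
    sqrt (set_lebesgue_integral lborel {0..L} (\<lambda>t. (u t)\<^sup>2)) * sqrt (set_lebesgue_integral lborel {0..L} (\<lambda>t. (g t)\<^sup>2))"
proof -
  have "(set_lebesgue_integral lborel {0..L} (\<lambda>t. \<bar>u t * g t\<bar>))\<^sup>2 \<le>
    set_lebesgue_integral lborel {0..L} (\<lambda>t. (u t)\<^sup>2) * set_lebesgue_integral lborel {0..L} (\<lambda>t. (g t)\<^sup>2)"
    by (intro set_integral_Cauchy_Schwarz H1_interval_integrable_square[OF assms] H1_interval_D(2)[OF assms]
       H1_interval_set_integrable_continuous_mult[OF assms] H1_interval_continuous[OF assms])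
  then show ?thesis by (metis real_le_rsqrt real_sqrt_mult)
qed

lemma sum_sqrt_mult_sqrt_le:
  fixes a b :: "'a \<Rightarrow> real"
  assumes "\<And>i. i \<in> S \<Longrightarrow> 0 \<le> a i" "\<And>i. i \<in> S \<Longrightarrow> 0 \<le> b i"
  shows "(\<Sum>i\<in>S. sqrt (a i) * sqrt (b i)) \<le> sqrt (sum a S * sum b S)"
proof -
  have "(\<Sum>i\<in>S. sqrt (a i) * sqrt (b i))\<^sup>2 \<le> (\<Sum>i\<in>S. (sqrt (a i))\<^sup>2) * (\<Sum>i\<in>S. (sqrt (b i))\<^sup>2)"
    by (rule Cauchy_Schwarz_ineq_sum)
  also have "\<dots> = sum a S * sum b S"
    using assms by simp
  finally show ?thesis by (rule real_le_rsqrt)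
qed

locale core_function = one_halfline +
  fixes u g :: "nat \<Rightarrow> real \<Rightarrow> real" and \<phi> :: "nat \<Rightarrow> real"
  assumes H1: "\<And>e. e \<in> edges G \<Longrightarrow> H1_interval (len G e) (u e) (g e)"
    and glued: "\<And>e. e \<in> edges G \<Longrightarrow> u e 0 = \<phi> (src G e)" "\<And>e. e \<in> edges G \<Longrightarrow> u e (len G e) = \<phi> (tgt G e)"
begin

definition "mass e = set_lebesgue_integral lborel {0..len G e} (\<lambda>t. (u e t)\<^sup>2)"
definition "kinetic e = set_lebesgue_integral lborel {0..len G e} (\<lambda>t. (g e t)\<^sup>2)"
abbreviation "Mass \<equiv> sum mass (edges G)"
abbreviation "Kinetic \<equiv> sum kinetic (edges G)"

lemma mass_nonneg: "0 \<le> mass e" and kinetic_nonneg: "0 \<le> kinetic e"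
  unfolding mass_def kinetic_def by (rule set_integral_nonneg', simp)+

lemma sum_mass_le: "S \<subseteq> edges G \<Longrightarrow> sum mass S \<le> Mass"
  and sum_kinetic_le: "S \<subseteq> edges G \<Longrightarrow> sum kinetic S \<le> Kinetic"
  using mass_nonneg kinetic_nonneg finite_edges by (auto intro!: sum_mono2)

lemma mass_le: "e \<in> edges G \<Longrightarrow> mass e \<le> Mass"
  and kinetic_le: "e \<in> edges G \<Longrightarrow> kinetic e \<le> Kinetic"
  using sum_mass_le[of "{e}"] sum_kinetic_le[of "{e}"] by auto

lemma Mass_nonneg: "0 \<le> Mass" and Kinetic_nonneg: "0 \<le> Kinetic"
  using mass_nonneg kinetic_nonneg by (auto intro!: sum_nonneg)

lemma edge_diff_sq_le:
  assumes "e \<in> edges G" "0 \<le> x" "x \<le> len G e"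
  shows "(u e x - \<phi> (src G e))\<^sup>2 \<le> len G e * kinetic e"
proof -
  have "(u e x - u e 0)\<^sup>2 \<le> (x - 0) * set_lebesgue_integral lborel {0..x} (\<lambda>t. (g e t)\<^sup>2)"
    using assms by (intro H1_interval_diff_sq_le[OF H1]) auto
  also have "\<dots> \<le> len G e * kinetic e"
    unfolding kinetic_def using assms len_pos[OF assms(1)]
    by (intro mult_mono set_integral_mono_set[OF H1_interval_D(2)[OF H1]] set_integral_nonneg') auto
  finally show ?thesis using glued assms by simp
qed

lemma edge_diff_squares_le:
  assumes "e \<in> edges G" "0 \<le> x" "x \<le> len G e"
  shows "\<bar>(u e x)\<^sup>2 - (\<phi> (src G e))\<^sup>2\<bar> \<le> 2 * (sqrt (mass e) * sqrt (kinetic e))"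
proof -
  have "\<bar>(u e x)\<^sup>2 - (u e 0)\<^sup>2\<bar> \<le> 2 * set_lebesgue_integral lborel {0..x} (\<lambda>t. \<bar>u e t * g e t\<bar>)"
    using assms by (intro H1_interval_diff_squares_le[OF H1]) auto
  also have "set_lebesgue_integral lborel {0..x} (\<lambda>t. \<bar>u e t * g e t\<bar>) \<le>
      set_lebesgue_integral lborel {0..len G e} (\<lambda>t. \<bar>u e t * g e t\<bar>)"
    using assms
    by (intro set_integral_mono_set set_integrable_abs H1_interval_set_integrable_continuous_mult[OF H1]
       H1_interval_continuous[OF H1]) auto
  also have "\<dots> \<le> sqrt (mass e) * sqrt (kinetic e)"
    unfolding mass_def kinetic_def by (rule H1_interval_abs_mult_integral_le[OF H1[OF assms(1)]])
  finally show ?thesis using glued assms by simp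
qed

text \<open>Cauchy-Schwarz over the edges of a walk from \<open>att G\<close>: however many they
  are, their total length is at most 2 * \<open>core_diam G\<close>. The edge e itself obeys the
  same length bound. Squaring the sum of the two contributions doubles each, hence 8.\<close>

lemma core_diff_sq_le:
  assumes e: "e \<in> edges G" and x: "0 \<le> x" "x \<le> len G e"
  shows "(u e x - \<phi> (att G))\<^sup>2 \<le> 8 * core_diam G * Kinetic"
proof -
  obtain L where L: "L \<le> 2 * core_diam G" "core_walk G (att G) (src G e) L"
    using walk_to_src[OF e] by blast
  obtain S where S: "S \<subseteq> edges G" "sum (len G) S \<le> L"
    "\<And>\<phi>::nat \<Rightarrow> real. \<bar>\<phi> (src G e) - \<phi> (att G)\<bar> \<le> (\<Sum>e\<in>S. \<bar>\<phi> (tgt G e) - \<phi> (src G e)\<bar>)"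
    using core_walk_diff_le[OF L(2)] finite_edges len_pos less_imp_le by metis
  have "\<bar>\<phi> (src G e) - \<phi> (att G)\<bar> \<le> (\<Sum>e\<in>S. \<bar>\<phi> (tgt G e) - \<phi> (src G e)\<bar>)" by (rule S(3))
  also have "\<dots> \<le> (\<Sum>e\<in>S. sqrt (len G e) * sqrt (kinetic e))"
  proof (rule sum_mono)
    fix e assume "e \<in> S"
    then have e: "e \<in> edges G" using S by blast
    show "\<bar>\<phi> (tgt G e) - \<phi> (src G e)\<bar> \<le> sqrt (len G e) * sqrt (kinetic e)"
      using edge_diff_sq_le[OF e, of "len G e"] len_pos[OF e] glued(2)[OF e]
      by (simp add: real_sqrt_mult[symmetric] real_le_rsqrt)
  qed
  also have "\<dots> \<le> sqrt (sum (len G) S * sum kinetic S)"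
    using S(1) len_pos kinetic_nonneg by (intro sum_sqrt_mult_sqrt_le) (auto intro: less_imp_le)
  also have "\<dots> \<le> sqrt (2 * core_diam G * Kinetic)"
    using S L sum_kinetic_le[OF S(1)] core_diam_pos kinetic_nonneg
    by (intro real_sqrt_le_mono mult_mono) (auto intro!: sum_nonneg)
  finally have 1: "(\<phi> (src G e) - \<phi> (att G))\<^sup>2 \<le> 2 * core_diam G * Kinetic"
    by (metis real_sqrt_abs real_sqrt_le_iff)
  have "(u e x - \<phi> (src G e))\<^sup>2 \<le> len G e * kinetic e" by (rule edge_diff_sq_le[OF assms])
  also have "\<dots> \<le> 2 * core_diam G * Kinetic"
    using len_le_core_diam[OF e] kinetic_le[OF e] kinetic_nonneg core_diam_pos by (intro mult_mono) auto
  finally have 2: "(u e x - \<phi> (src G e))\<^sup>2 \<le> 2 * core_diam G * Kinetic" .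
  have "(u e x - \<phi> (att G))\<^sup>2 \<le> 2 * (u e x - \<phi> (src G e))\<^sup>2 + 2 * (\<phi> (src G e) - \<phi> (att G))\<^sup>2"
    using sum_squares_ge_zero[of "u e x - \<phi> (src G e) - (\<phi> (src G e) - \<phi> (att G))" 0]
    by (simp add: power2_eq_square algebra_simps)
  then show ?thesis using 1 2 by linarith
qed

text \<open>A walk is followed with the squares of the vertex values, so no length enters. This is a
  Gagliardo-Nirenberg bound on the core with a constant valid for all graphs; it serves the a priori
  bound on the kinetic energy, while \<open>core_diff_sq_le\<close> provides smallness.\<close>

lemma core_diff_squares_le:
  assumes e: "e \<in> edges G" and x: "0 \<le> x" "x \<le> len G e"
  shows "\<bar>(u e x)\<^sup>2 - (\<phi> (att G))\<^sup>2\<bar> \<le> 4 * sqrt (Mass * Kinetic)"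
proof -
  obtain L where L: "core_walk G (att G) (src G e) L"
    using walk_to_src[OF e] by blast
  obtain S where S: "S \<subseteq> edges G"
    "\<And>\<phi>::nat \<Rightarrow> real. \<bar>\<phi> (src G e) - \<phi> (att G)\<bar> \<le> (\<Sum>e\<in>S. \<bar>\<phi> (tgt G e) - \<phi> (src G e)\<bar>)"
    using core_walk_diff_le[OF L] finite_edges len_pos less_imp_le by metis
  have "\<bar>(\<phi> (src G e))\<^sup>2 - (\<phi> (att G))\<^sup>2\<bar> \<le> (\<Sum>e\<in>S. \<bar>(\<phi> (tgt G e))\<^sup>2 - (\<phi> (src G e))\<^sup>2\<bar>)"
    by (rule S(2)[of "\<lambda>v. (\<phi> v)\<^sup>2"])
  also have "\<dots> \<le> (\<Sum>e\<in>S. 2 * (sqrt (mass e) * sqrt (kinetic e)))"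
  proof (rule sum_mono)
    fix e assume "e \<in> S"
    then have e: "e \<in> edges G" using S by blast
    show "\<bar>(\<phi> (tgt G e))\<^sup>2 - (\<phi> (src G e))\<^sup>2\<bar> \<le> 2 * (sqrt (mass e) * sqrt (kinetic e))"
      using edge_diff_squares_le[OF e, of "len G e"] len_pos[OF e] glued(2)[OF e] by simp
  qed
  also have "\<dots> \<le> 2 * sqrt (sum mass S * sum kinetic S)"
    using sum_sqrt_mult_sqrt_le[of S mass kinetic] mass_nonneg kinetic_nonneg
    by (simp add: sum_distrib_left[symmetric])
  also have "\<dots> \<le> 2 * sqrt (Mass * Kinetic)"
    using sum_kinetic_le[OF S(1)] sum_mass_le[OF S(1)] mass_nonneg kinetic_nonneg
    by (intro mult_left_mono real_sqrt_le_mono mult_mono) (auto intro!: sum_nonneg)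
  finally have 1: "\<bar>(\<phi> (src G e))\<^sup>2 - (\<phi> (att G))\<^sup>2\<bar> \<le> 2 * sqrt (Mass * Kinetic)" .
  have "\<bar>(u e x)\<^sup>2 - (\<phi> (src G e))\<^sup>2\<bar> \<le> 2 * (sqrt (mass e) * sqrt (kinetic e))"
    by (rule edge_diff_squares_le[OF assms])
  also have "\<dots> \<le> 2 * sqrt (Mass * Kinetic)"
    unfolding real_sqrt_mult[symmetric] using mass_le[OF e] kinetic_le[OF e] kinetic_nonneg mass_nonneg Mass_nonneg
    by (intro mult_left_mono real_sqrt_le_mono mult_mono) auto
  finally show ?thesis using 1 by linarith
qed

text \<open>The squared value at \<open>att G\<close> is at most 2 * u^2 plus twice the squared
  oscillation; this is integrated over the core. After division by the length, a long core of given
  mass forces a small value at \<open>att G\<close>.\<close>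

lemma core_length_mult_att_sq_le:
  "core_length G * (\<phi> (att G))\<^sup>2 \<le> 2 * Mass + core_length G * (16 * core_diam G * Kinetic)"
proof -
  let ?c = "16 * core_diam G * Kinetic"
  have "len G e * (\<phi> (att G))\<^sup>2 \<le> 2 * mass e + len G e * ?c" if e: "e \<in> edges G" for e
  proof -
    have "len G e * (\<phi> (att G))\<^sup>2 = set_lebesgue_integral lborel {0..len G e} (\<lambda>t. (\<phi> (att G))\<^sup>2)"
      using len_pos[OF e] by (simp add: set_lebesgue_integral_def)
    also have "\<dots> \<le> set_lebesgue_integral lborel {0..len G e} (\<lambda>t. 2 * (u e t)\<^sup>2 + ?c)"
    proof (intro set_integral_mono set_integral_add set_integrable_mult_right
        H1_interval_integrable_square[OF H1[OF e]] borel_integrable_atLeastAtMost' continuous_intros)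
      fix t assume "t \<in> {0..len G e}"
      then have "(u e t - \<phi> (att G))\<^sup>2 \<le> 8 * core_diam G * Kinetic" using core_diff_sq_le[OF e] by simp
      moreover have "(\<phi> (att G))\<^sup>2 \<le> 2 * (u e t)\<^sup>2 + 2 * (u e t - \<phi> (att G))\<^sup>2"
        using sum_squares_ge_zero[of "u e t - (\<phi> (att G) - u e t)" 0]
        by (simp add: power2_eq_square algebra_simps)
      ultimately show "(\<phi> (att G))\<^sup>2 \<le> 2 * (u e t)\<^sup>2 + ?c" by linarith
    qed
    also have "\<dots> = set_lebesgue_integral lborel {0..len G e} (\<lambda>t. 2 * (u e t)\<^sup>2) +
        set_lebesgue_integral lborel {0..len G e} (\<lambda>t. ?c)"
      by (intro set_integral_add set_integrable_mult_right
        H1_interval_integrable_square[OF H1[OF e]] borel_integrable_atLeastAtMost' continuous_intros)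
    also have "\<dots> = 2 * mass e + len G e * ?c"
      using len_pos[OF e] unfolding mass_def by (simp add: set_lebesgue_integral_def)
    finally show ?thesis .
  qed
  then have "(\<Sum>e\<in>edges G. len G e * (\<phi> (att G))\<^sup>2) \<le> (\<Sum>e\<in>edges G. 2 * mass e + len G e * ?c)"
    by (rule sum_mono)
  then show ?thesis
    unfolding core_length_def by (simp add: sum.distrib sum_distrib_left[symmetric] sum_distrib_right[symmetric])
qed

lemma core_powr_integral_le:
  assumes "2 < p" and B: "\<And>e x. e \<in> edges G \<Longrightarrow> 0 \<le> x \<Longrightarrow> x \<le> len G e \<Longrightarrow> (u e x)\<^sup>2 \<le> B"
  shows "(\<Sum>e\<in>edges G. set_lebesgue_integral lborel {0..len G e} (\<lambda>t. \<bar>u e t\<bar> powr p)) \<le> B powr ((p - 2) / 2) * Mass"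
  unfolding sum_distrib_left
proof (rule sum_mono)
  fix e assume e: "e \<in> edges G"
  have "set_lebesgue_integral lborel {0..len G e} (\<lambda>t. \<bar>u e t\<bar> powr p) \<le>
      set_lebesgue_integral lborel {0..len G e} (\<lambda>t. B powr ((p - 2) / 2) * (u e t)\<^sup>2)"
    using H1[OF e] assms e
    by (intro set_integral_mono set_integrable_mult_right H1_interval_integrable_square
       H1_interval_integrable_powr abs_powr_le_powr_mult_sq) auto
  then show "set_lebesgue_integral lborel {0..len G e} (\<lambda>t. \<bar>u e t\<bar> powr p) \<le> B powr ((p - 2) / 2) * mass e"
    by (simp add: mass_def)
qed

end

subsection \<open>Functions on the half-line\<close>

definition half_mass :: "(real \<Rightarrow> real) \<Rightarrow> real" where
  "half_mass w = set_lebesgue_integral lborel {0..} (\<lambda>t. (w t)\<^sup>2)"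

definition half_powr :: "real \<Rightarrow> (real \<Rightarrow> real) \<Rightarrow> real" where
  "half_powr p w = set_lebesgue_integral lborel {0..} (\<lambda>t. \<bar>w t\<bar> powr p)"

definition half_energy :: "real \<Rightarrow> (real \<Rightarrow> real) \<Rightarrow> (real \<Rightarrow> real) \<Rightarrow> real" where
  "half_energy p w g = 1/2 * half_mass g - 1/p * half_powr p w"

lemma half_mass_nonneg: "0 \<le> half_mass w"
  unfolding half_mass_def by (rule set_integral_nonneg') simp

lemma half_powr_nonneg: "0 \<le> half_powr p w"
  unfolding half_powr_def by (rule set_integral_nonneg') simp

text \<open>w x is compared with the values on a window [x, x + h]. This costs the mass divided by h
  plus h times the kinetic integral, and h is then optimised by
  \<open>sq_le_mult_if_AMGM\<close>.\<close>

lemma H1_halfline_sq_le: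
  assumes H: "H1_halfline w g" and x: "0 \<le> x"
  shows "(w x)\<^sup>2 \<le> 4 * sqrt (half_mass w * half_mass g)"
proof -
  have "((w x)\<^sup>2)\<^sup>2 \<le> (4 * half_mass g) * (4 * half_mass w)"
  proof (rule sq_le_mult_if_AMGM)
    fix h :: real assume h: "0 < h"
    have I: "set_integrable lborel {x..x+h} (\<lambda>t. (w t)\<^sup>2)"
      using x by (intro set_integrable_subset[OF H1_halfline_D(3)[OF H]]) auto
    have "h * (w x)\<^sup>2 = set_lebesgue_integral lborel {x..x+h} (\<lambda>t. (w x)\<^sup>2)"
      using h by (simp add: set_lebesgue_integral_def)
    also have "\<dots> \<le> set_lebesgue_integral lborel {x..x+h} (\<lambda>t. 2 * (w t)\<^sup>2 + 2 * h * half_mass g)"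
    proof (intro set_integral_mono set_integral_add set_integrable_mult_right I
        borel_integrable_atLeastAtMost' continuous_intros)
      fix t assume t: "t \<in> {x..x+h}"
      have "(w t - w x)\<^sup>2 \<le> (t - x) * set_lebesgue_integral lborel {x..t} (\<lambda>t. (g t)\<^sup>2)"
        using t x by (intro H1_interval_diff_sq_le[OF H1_halfline_restrict[OF H, of t]]) auto
      also have "\<dots> \<le> h * half_mass g"
        unfolding half_mass_def using t x h
        by (intro mult_mono set_integral_mono_set[OF H1_halfline_D(2)[OF H]] set_integral_nonneg') auto
      finally have "(w t - w x)\<^sup>2 \<le> h * half_mass g" .
      moreover have "(w x)\<^sup>2 \<le> 2 * (w t)\<^sup>2 + 2 * (w t - w x)\<^sup>2"
        using sum_squares_ge_zero[of "w t - (w x - w t)" 0]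
        by (simp add: power2_eq_square algebra_simps)
      ultimately show "(w x)\<^sup>2 \<le> 2 * (w t)\<^sup>2 + 2 * h * half_mass g" by linarith
    qed
    also have "\<dots> = set_lebesgue_integral lborel {x..x+h} (\<lambda>t. 2 * (w t)\<^sup>2) +
        set_lebesgue_integral lborel {x..x+h} (\<lambda>t. 2 * h * half_mass g)"
      by (intro set_integral_add set_integrable_mult_right I borel_integrable_atLeastAtMost' continuous_intros)
    also have "\<dots> = 2 * set_lebesgue_integral lborel {x..x+h} (\<lambda>t. (w t)\<^sup>2) + h * (2 * h * half_mass g)"
      using h by (simp add: set_lebesgue_integral_def)
    also have "set_lebesgue_integral lborel {x..x+h} (\<lambda>t. (w t)\<^sup>2) \<le> half_mass w"
      unfolding half_mass_def using x by (intro set_integral_mono_set[OF H1_halfline_D(3)[OF H]]) auto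
    finally have "h * (w x)\<^sup>2 \<le> 2 * half_mass w + h * (2 * h * half_mass g)" by simp
    then show "2 * (w x)\<^sup>2 \<le> h * (4 * half_mass g) + 4 * half_mass w / h"
      using h by (simp add: field_simps)
  qed (use half_mass_nonneg in auto)
  then have "(w x)\<^sup>2 \<le> sqrt (4\<^sup>2 * (half_mass w * half_mass g))"
    by (intro real_le_rsqrt) (simp add: mult_ac)
  then show ?thesis unfolding real_sqrt_mult by simp
qed

lemma H1_halfline_continuous:
  assumes "H1_halfline w g"
  shows "continuous_on {0..} w"
  unfolding continuous_on_eq_continuous_within
proof
  fix x :: real assume x: "x \<in> {0..}"
  have "continuous (at x within {0..x+1}) w"
    using H1_interval_continuous[OF H1_halfline_restrict[OF assms, of "x+1"]] x
    unfolding continuous_on_eq_continuous_within by auto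
  also have "at x within {0..x+1} = at x within {0..}"
    using x by (intro at_within_nhd[of x "{..<x+1}"]) auto
  finally show "continuous (at x within {0..}) w" .
qed

lemma
  assumes H: "H1_halfline w g" and p: "2 < p" and B: "\<And>x. 0 \<le> x \<Longrightarrow> (w x)\<^sup>2 \<le> B"
  shows H1_halfline_integrable_powr: "set_integrable lborel {0..} (\<lambda>t. \<bar>w t\<bar> powr p)"
    and half_powr_le: "half_powr p w \<le> B powr ((p - 2) / 2) * half_mass w"
proof -
  have 1: "set_integrable lborel {0..} (\<lambda>t. B powr ((p - 2) / 2) * (w t)\<^sup>2)"
    using H1_halfline_D(3)[OF H] by simp
  have "set_borel_measurable borel {0..} (\<lambda>t. \<bar>w t\<bar> powr p)"
    using H1_halfline_continuous[OF H] p
    by (intro set_measurable_continuous_on continuous_intros continuous_on_powr') auto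
  then show 2: "set_integrable lborel {0..} (\<lambda>t. \<bar>w t\<bar> powr p)"
    using abs_powr_le_powr_mult_sq[OF B p]
    by (intro set_integrable_bound[OF 1]) (auto simp: set_borel_measurable_def)
  show "half_powr p w \<le> B powr ((p - 2) / 2) * half_mass w"
    unfolding half_powr_def half_mass_def set_integral_mult_right[symmetric]
    by (intro set_integral_mono 2 1 abs_powr_le_powr_mult_sq B p) simp
qed

section \<open>Dilations and concatenation of functions on the half-line\<close>

lemma
  fixes f :: "real \<Rightarrow> real"
  assumes "0 < b"
  shows set_integrable_lborel_affine_iff:
      "set_integrable lborel {x. t + b * x \<in> S} (\<lambda>x. f (t + b * x)) \<longleftrightarrow> set_integrable lborel S f"
    and set_integral_lborel_affine:
      "set_lebesgue_integral lborel {x. t + b * x \<in> S} (\<lambda>x. f (t + b * x)) = set_lebesgue_integral lborel S f / b"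
proof -
  have eq: "(\<lambda>x. indicator {x. t + b * x \<in> S} x *\<^sub>R f (t + b * x)) = (\<lambda>x. (\<lambda>y. indicator S y *\<^sub>R f y) (t + b * x))"
    by (auto simp: indicator_def)
  show "set_integrable lborel {x. t + b * x \<in> S} (\<lambda>x. f (t + b * x)) \<longleftrightarrow> set_integrable lborel S f"
    unfolding set_integrable_def eq using assms by (intro lborel_integrable_real_affine_iff) simp
  show "set_lebesgue_integral lborel {x. t + b * x \<in> S} (\<lambda>x. f (t + b * x)) = set_lebesgue_integral lborel S f / b"
    unfolding set_lebesgue_integral_def eq
    using lborel_integral_real_affine[of b "\<lambda>y. indicator S y *\<^sub>R f y" t] assms by simp
qed

lemma dilation_preimages:
  fixes b :: real
  assumes "0 < b"
  shows "{x. 0 + b * x \<in> {0..}} = {0..}" "{x. 0 + b * x \<in> {0..b * y}} = {0..y}"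
  using assms by (simp_all add: set_eq_iff zero_le_mult_iff mult_le_cancel_left_pos)

lemma H1_halfline_scale:
  assumes H: "H1_halfline w g" and ab: "0 < a" "0 < b"
  defines "w' \<equiv> \<lambda>x. a * w (b * x)" and "g' \<equiv> \<lambda>x. a * b * g (b * x)"
  shows "H1_halfline w' g'" "half_mass w' = a\<^sup>2 / b * half_mass w" "half_mass g' = a\<^sup>2 * b * half_mass g"
    "half_powr p w' = a powr p / b * half_powr p w"
proof -
  note int = set_integrable_lborel_affine_iff[OF ab(2), of 0 "{0..}", unfolded dilation_preimages[OF ab(2)], simplified]
  note LINT = set_integral_lborel_affine[OF ab(2), of 0 "{0..}", unfolded dilation_preimages[OF ab(2)], simplified]
  note intI = set_integrable_lborel_affine_iff[OF ab(2), of 0 "{0..b * y}" for y, unfolded dilation_preimages[OF ab(2)], simplified]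
  note LINTI = set_integral_lborel_affine[OF ab(2), of 0 "{0..b * y}" for y, unfolded dilation_preimages[OF ab(2)], simplified]
  show "H1_halfline w' g'"
    unfolding H1_halfline_def
  proof (intro conjI allI impI)
    fix x :: real assume x: "0 \<le> x"
    have "set_integrable lborel {0..b * x} g" using H1_halfline_D(1)[OF H] ab x by simp
    then show "set_integrable lborel {0..x} g'" unfolding g'_def by (intro set_integrable_mult_right) (simp add: intI)
    have "set_lebesgue_integral lborel {0..x} g' = a * b * set_lebesgue_integral lborel {0..x} (\<lambda>x. g (b * x))"
      unfolding g'_def by simp
    also have "\<dots> = a * set_lebesgue_integral lborel {0..b * x} g" using ab by (simp add: LINTI)
    finally show "w' x = w' 0 + set_lebesgue_integral lborel {0..x} g'"
      using H1_halfline_D(4)[OF H, of "b * x"] x ab by (simp add: w'_def algebra_simps)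
  next
    show "set_integrable lborel {0..} (\<lambda>t. (g' t)\<^sup>2)"
      using int[of "\<lambda>t. (g t)\<^sup>2"] H1_halfline_D(2)[OF H] by (simp add: g'_def power_mult_distrib)
    show "set_integrable lborel {0..} (\<lambda>t. (w' t)\<^sup>2)"
      using int[of "\<lambda>t. (w t)\<^sup>2"] H1_halfline_D(3)[OF H] by (simp add: w'_def power_mult_distrib)
  qed
  show "half_mass w' = a\<^sup>2 / b * half_mass w"
    using LINT[of "\<lambda>t. (w t)\<^sup>2"] by (simp add: half_mass_def w'_def power_mult_distrib)
  show "half_mass g' = a\<^sup>2 * b * half_mass g"
  proof -
    have "half_mass g' = a\<^sup>2 * b\<^sup>2 * (half_mass g / b)"
      using LINT[of "\<lambda>t. (g t)\<^sup>2"] by (simp add: half_mass_def g'_def power_mult_distrib)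
    then show ?thesis using ab by (simp add: power2_eq_square)
  qed
  show "half_powr p w' = a powr p / b * half_powr p w"
    using LINT[of "\<lambda>t. \<bar>w t\<bar> powr p"] ab by (simp add: half_powr_def w'_def powr_mult abs_mult)
qed

definition glue :: "real \<Rightarrow> (real \<Rightarrow> real) \<Rightarrow> (real \<Rightarrow> real) \<Rightarrow> real \<Rightarrow> real" where
  "glue L v w x = (if x \<le> L then v x else w (x - L))"

text \<open>A will be {0..} for the norms and {0..x - L} for the primitive of a glued
  derivative.\<close>

lemma
  assumes L: "0 \<le> L" and A: "A \<subseteq> {0..}" "A \<in> sets borel"
    and f: "set_integrable lborel {0..L} f" and h: "set_integrable lborel A h"
  shows set_integrable_glue: "set_integrable lborel ({0..L} \<union> {t. t - L \<in> A}) (glue L f h)"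
    and set_integral_glue: "set_lebesgue_integral lborel ({0..L} \<union> {t. t - L \<in> A}) (glue L f h) =
       set_lebesgue_integral lborel {0..L} f + set_lebesgue_integral lborel A h"
proof -
  let ?B = "{t. t - L \<in> A}"
  have B: "?B \<in> sets borel" using A(2) by measurable
  note af = set_integrable_lborel_affine_iff[of 1 "-L" A h] set_integral_lborel_affine[of 1 "-L" A h]
  have hB: "set_integrable lborel ?B (\<lambda>t. h (t - L))" "set_lebesgue_integral lborel ?B (\<lambda>t. h (t - L)) = set_lebesgue_integral lborel A h"
    using af h by simp_all
  have 1: "set_integrable lborel {0..L} (glue L f h) \<longleftrightarrow> set_integrable lborel {0..L} f"
    by (rule set_integrable_cong) (auto simp: glue_def)
  have 2: "set_lebesgue_integral lborel {0..L} (glue L f h) = set_lebesgue_integral lborel {0..L} f"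
    by (rule set_lebesgue_integral_cong) (auto simp: glue_def)
  \<comment> \<open>The pieces may meet in the point L, where \<open>glue\<close> takes the value of
    the left one; this null set is removed before comparing with h.\<close>
  have disc: "set_integrable lborel ?B (glue L f h) \<longleftrightarrow> set_integrable lborel (?B - {L}) (glue L f h)"
     "set_lebesgue_integral lborel ?B (glue L f h) = set_lebesgue_integral lborel (?B - {L}) (glue L f h)"
     "set_integrable lborel ?B (\<lambda>t. h (t - L)) \<longleftrightarrow> set_integrable lborel (?B - {L}) (\<lambda>t. h (t - L))"
     "set_lebesgue_integral lborel ?B (\<lambda>t. h (t - L)) = set_lebesgue_integral lborel (?B - {L}) (\<lambda>t. h (t - L))"
    by (rule set_integrable_discrete_difference[of "{L}"] set_integral_discrete_difference[of "{L}"]; auto)+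
  have 3: "set_integrable lborel (?B - {L}) (glue L f h) \<longleftrightarrow> set_integrable lborel (?B - {L}) (\<lambda>t. h (t - L))"
    using A(1) by (intro set_integrable_cong) (auto simp: glue_def)
  have 4: "set_lebesgue_integral lborel (?B - {L}) (glue L f h) = set_lebesgue_integral lborel (?B - {L}) (\<lambda>t. h (t - L))"
    using A B by (intro set_lebesgue_integral_cong) (auto simp: glue_def)
  have gB: "set_integrable lborel ?B (glue L f h)" "set_lebesgue_integral lborel ?B (glue L f h) = set_lebesgue_integral lborel A h"
    using disc 3 4 hB by simp_all
  have gL: "set_integrable lborel {0..L} (glue L f h)" using 1 f by simp
  show "set_integrable lborel ({0..L} \<union> ?B) (glue L f h)"
    using gL gB(1) B by (intro set_integrable_Un) auto
  have "AE x in lborel. \<not> (x \<in> {0..L} \<and> x \<in> ?B)"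
    using AE_lborel_singleton[of L] by eventually_elim (use A(1) in auto)
  then have "set_lebesgue_integral lborel ({0..L} \<union> ?B) (glue L f h) =
      set_lebesgue_integral lborel {0..L} (glue L f h) + set_lebesgue_integral lborel ?B (glue L f h)"
    using B gL gB(1) by (intro set_integral_Un_AE) auto
  then show "set_lebesgue_integral lborel ({0..L} \<union> ?B) (glue L f h) =
       set_lebesgue_integral lborel {0..L} f + set_lebesgue_integral lborel A h"
    using 2 gB(2) by simp
qed

lemma glue_compose: "F (glue L v w t) = glue L (\<lambda>t. F (v t)) (\<lambda>t. F (w t)) t"
  by (simp add: glue_def)

lemma
  assumes L: "0 \<le> L" and v: "H1_interval L v k" and w: "H1_halfline w g" and eq: "v L = w 0"
  shows H1_halfline_glue: "H1_halfline (glue L v w) (glue L k g)"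
    and half_mass_glue: "half_mass (glue L v w) = set_lebesgue_integral lborel {0..L} (\<lambda>t. (v t)\<^sup>2) + half_mass w"
    and half_mass_glue_deriv: "half_mass (glue L k g) = set_lebesgue_integral lborel {0..L} (\<lambda>t. (k t)\<^sup>2) + half_mass g"
    and half_powr_glue: "2 < p \<Longrightarrow> half_powr p (glue L v w) = set_lebesgue_integral lborel {0..L} (\<lambda>t. \<bar>v t\<bar> powr p) + half_powr p w"
proof -
  have U: "{0..} = {0..L} \<union> {t. t - L \<in> {0..}}" using L by auto
  have Uy: "{0..x} = {0..L} \<union> {t. t - L \<in> {0..x - L}}" if "L < x" for x using that L by auto
  show "H1_halfline (glue L v w) (glue L k g)"
    unfolding H1_halfline_def
  proof (intro conjI allI impI)
    fix x :: real assume x: "0 \<le> x"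
    show "set_integrable lborel {0..x} (glue L k g)"
    proof (cases "x \<le> L")
      case True
      have "set_integrable lborel {0..x} k"
        using True by (intro set_integrable_subset[OF H1_interval_D(1)[OF v]]) auto
      also have "?this \<longleftrightarrow> ?thesis" using True by (intro set_integrable_cong) (auto simp: glue_def)
      finally show ?thesis .
    next
      case False
      then show ?thesis
        using set_integrable_glue[OF L, of "{0..x - L}", OF _ _ H1_interval_D(1)[OF v] H1_halfline_D(1)[OF w]] Uy by simp
    qed
    show "glue L v w x = glue L v w 0 + set_lebesgue_integral lborel {0..x} (glue L k g)"
    proof (cases "x \<le> L")
      case True
      have "set_lebesgue_integral lborel {0..x} (glue L k g) = set_lebesgue_integral lborel {0..x} k"
        using True by (intro set_lebesgue_integral_cong) (auto simp: glue_def)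
      then show ?thesis using H1_interval_D(3)[OF v x True] True L by (simp add: glue_def)
    next
      case False
      then have "set_lebesgue_integral lborel {0..x} (glue L k g) =
          set_lebesgue_integral lborel {0..L} k + set_lebesgue_integral lborel {0..x - L} g"
        using set_integral_glue[OF L, of "{0..x - L}", OF _ _ H1_interval_D(1)[OF v] H1_halfline_D(1)[OF w]] Uy by simp
      then show ?thesis
        using H1_interval_D(3)[OF v L] H1_halfline_D(4)[OF w, of "x - L"] False L eq by (simp add: glue_def)
    qed
  next
    show "set_integrable lborel {0..} (\<lambda>t. (glue L k g t)\<^sup>2)"
      using set_integrable_glue[OF L _ _ H1_interval_D(2)[OF v] H1_halfline_D(2)[OF w]]
      unfolding U[symmetric] glue_compose[of "\<lambda>x. x\<^sup>2"] by simp
    show "set_integrable lborel {0..} (\<lambda>t. (glue L v w t)\<^sup>2)"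
      using set_integrable_glue[OF L _ _ H1_interval_integrable_square[OF v] H1_halfline_D(3)[OF w]]
      unfolding U[symmetric] glue_compose[of "\<lambda>x. x\<^sup>2"] by simp
  qed
  show "half_mass (glue L v w) = set_lebesgue_integral lborel {0..L} (\<lambda>t. (v t)\<^sup>2) + half_mass w"
    using set_integral_glue[OF L _ _ H1_interval_integrable_square[OF v] H1_halfline_D(3)[OF w]]
    unfolding U[symmetric] half_mass_def glue_compose[of "\<lambda>x. x\<^sup>2"] by simp
  show "half_mass (glue L k g) = set_lebesgue_integral lborel {0..L} (\<lambda>t. (k t)\<^sup>2) + half_mass g"
    using set_integral_glue[OF L _ _ H1_interval_D(2)[OF v] H1_halfline_D(2)[OF w]]
    unfolding U[symmetric] half_mass_def glue_compose[of "\<lambda>x. x\<^sup>2"] by simp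
  show "half_powr p (glue L v w) = set_lebesgue_integral lborel {0..L} (\<lambda>t. \<bar>v t\<bar> powr p) + half_powr p w" if "2 < p"
    using set_integral_glue[OF L _ _ H1_interval_integrable_powr[OF v] H1_halfline_integrable_powr[OF w that H1_halfline_sq_le[OF w]]] that
    unfolding U[symmetric] half_powr_def glue_compose[of "\<lambda>x. \<bar>x\<bar> powr p"] by simp
qed

subsection \<open>The energy level of the half-line\<close>

lemma set_integrable_Icc_const [simp]: "set_integrable lborel {a..b::real} (\<lambda>t. c::real)"
  by (intro borel_integrable_atLeastAtMost') simp

lemma set_integral_Icc_const: "a \<le> b \<Longrightarrow> set_lebesgue_integral lborel {a..b::real} (\<lambda>t. c::real) = c * (b - a)"
  by (simp add: set_lebesgue_integral_def)

lemma H1_interval_affine: "H1_interval L (\<lambda>x. c + d * x) (\<lambda>x. d)"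
  by (auto simp: H1_interval_def set_integral_Icc_const)

lemma H1_halfline_zero: "H1_halfline (\<lambda>x. 0) (\<lambda>x. 0)"
  by (simp add: H1_halfline_def set_integrable_def)

lemma half_powr_eq_0_if_half_mass_eq_0:
  assumes H: "H1_halfline w g" and "half_mass w = 0" "2 < p"
  shows "half_powr p w = 0"
  using half_powr_le[OF H assms(3) H1_halfline_sq_le[OF H]] assms(2) half_powr_nonneg[of p w] by simp

lemma H1_halfline_test_function:
  assumes "2 < p"
  obtains w g where "H1_halfline w g" "w 0 = 0" "0 < half_mass w" "0 < half_powr p w"
proof
  \<comment> \<open>The function is a tent: slope 1 on [0, 1], slope -1 on [1, 2], then 0. Its
    p-integral is bounded below on [1/2, 1].\<close>
  define v where "v = glue 1 (\<lambda>x. 1 + (-1) * x) (\<lambda>x. 0)"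
  define k where "k = glue 1 (\<lambda>x. -1) (\<lambda>x. 0)"
  let ?w = "glue 1 (\<lambda>x. 0 + 1 * x) v" and ?g = "glue 1 (\<lambda>x. 1) k"
  have v: "H1_halfline v k" unfolding v_def k_def
    by (intro H1_halfline_glue H1_interval_affine H1_halfline_zero) auto
  show w: "H1_halfline ?w ?g"
    by (intro H1_halfline_glue H1_interval_affine v) (auto simp: v_def glue_def)
  show "?w 0 = 0" by (simp add: glue_def)
  have I: "set_integrable lborel {0..1} (\<lambda>t. \<bar>0 + 1 * t\<bar> powr p)"
    using assms by (intro H1_interval_integrable_powr[OF H1_interval_affine]) auto
  have "0 < (1/2::real) powr p * (1 - 1/2)" by simp
  also have "\<dots> = set_lebesgue_integral lborel {1/2..1::real} (\<lambda>t. (1/2) powr p)"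
    by (subst set_integral_Icc_const) auto
  also have "\<dots> \<le> set_lebesgue_integral lborel {1/2..1::real} (\<lambda>t. \<bar>0 + 1 * t\<bar> powr p)"
    using assms by (intro set_integral_mono set_integrable_subset[OF I] powr_mono2) auto
  also have "\<dots> \<le> set_lebesgue_integral lborel {0..1} (\<lambda>t. \<bar>0 + 1 * t\<bar> powr p)"
    by (intro set_integral_mono_set[OF I]) auto
  also have "\<dots> \<le> half_powr p ?w"
    by (subst half_powr_glue[OF _ H1_interval_affine v]) (use assms half_powr_nonneg in \<open>auto simp: v_def glue_def\<close>)
  finally show pos: "0 < half_powr p ?w" .
  show "0 < half_mass ?w"
    using half_mass_nonneg[of ?w] pos half_powr_eq_0_if_half_mass_eq_0[OF w _ assms] by (metis less_eq_real_def less_irrefl)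
qed

locale subcritical =
  fixes p :: real
  assumes p: "2 < p" "p < 6"
begin

text \<open>\<gamma> is the power of the mass in the level, dictated by scaling. The exponent q
  comes from splitting |u|^p into (u^2)^q * u^2 and bounding the first factor uniformly; p < 6 means
  q / 2 < 1.\<close>

definition "\<gamma> = (p + 2) / (6 - p)"
definition "q = (p - 2) / 2"

lemma q_pos: "0 < q" and q_less: "q < 2" and \<gamma>_gt_1: "1 < \<gamma>"
  using p by (auto simp: q_def \<gamma>_def field_simps)

lemma \<gamma>_eq: "(1 + q / 2) / (1 - q / 2) = \<gamma>"
  using p by (simp add: q_def \<gamma>_def field_simps)

section \<open>Gagliardo-Nirenberg estimates with constants depending on p only\<close>

lemma GN_powr_eq:
  assumes "0 < M" "0 < T"
  shows "(8 * sqrt (M * T)) powr q * M = 8 powr q * M powr (1 + q / 2) * T powr (q / 2)"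
proof -
  have "sqrt (M * T) powr q = M powr (q/2) * T powr (q/2)"
    using assms by (simp add: powr_half_sqrt[symmetric] powr_powr powr_mult)
  then show ?thesis using assms by (simp add: powr_mult powr_add)
qed

text \<open>T <= K * M powr (1 + q / 2) * T powr (q / 2) is solved for T, which is possible since q
  / 2 < 1; the resulting exponent is \<gamma> by \<open>\<gamma>_eq\<close>. The 8 is chosen for the
  whole graph: 4 for the value at the attachment vertex and 4 for the variation over the
  core.\<close>

lemma kinetic_bound:
  obtains t0 where "0 < t0" "\<And>M T. 0 < M \<Longrightarrow> 0 \<le> T \<Longrightarrow>
    T / 2 \<le> (8 * sqrt (M * T)) powr q * M / p \<Longrightarrow> T \<le> t0 * M powr \<gamma>"
proof
  define K where "K = 2 * 8 powr q / p"
  have K: "K > 0" using p by (simp add: K_def)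
  show "0 < K powr (1 / (1 - q / 2))" using K by simp
  fix M T :: real
  assume M: "0 < M" and T: "0 \<le> T" and le: "T / 2 \<le> (8 * sqrt (M * T)) powr q * M / p"
  show "T \<le> K powr (1 / (1 - q / 2)) * M powr \<gamma>"
  proof (cases "T = 0")
    case False
    then have T: "T > 0" using T by simp
    have "T powr (1 - q / 2) * T powr (q / 2) = T" using T by (simp add: powr_add[symmetric])
    also have "T \<le> K * M powr (1 + q / 2) * T powr (q / 2)"
      using le unfolding GN_powr_eq[OF M T] K_def by (simp add: field_simps)
    finally have "T powr (1 - q / 2) \<le> K * M powr (1 + q / 2)" using T by simp
    then have "(T powr (1 - q / 2)) powr (1 / (1 - q / 2)) \<le> (K * M powr (1 + q / 2)) powr (1 / (1 - q / 2))"
      using q_less by (intro powr_mono2) auto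
    also have "(T powr (1 - q / 2)) powr (1 / (1 - q / 2)) = T"
      using q_less T by (simp add: powr_powr)
    also have "(K * M powr (1 + q / 2)) powr (1 / (1 - q / 2)) = K powr (1 / (1 - q / 2)) * M powr \<gamma>"
      using K by (simp add: powr_mult powr_powr flip: \<gamma>_eq)
    finally show ?thesis .
  qed (use K in auto)
qed

text \<open>Above the threshold of \<open>kinetic_bound\<close> the right-hand side is nonnegative.
  Below it, T in the negative term is replaced by the threshold, and the powers of M again combine
  to \<gamma>.\<close>

lemma GN_energy_bound:
  obtains C where "\<And>M T. 0 < M \<Longrightarrow> 0 \<le> T \<Longrightarrow> - C * M powr \<gamma> \<le> T / 2 - (8 * sqrt (M * T)) powr q * M / p"
proof -
  obtain t0 where t0: "0 < t0" "\<And>M T. 0 < M \<Longrightarrow> 0 \<le> T \<Longrightarrow>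
    T / 2 \<le> (8 * sqrt (M * T)) powr q * M / p \<Longrightarrow> T \<le> t0 * M powr \<gamma>"
    using kinetic_bound by blast
  define C where "C = 8 powr q * t0 powr (q / 2) / p"
  have C: "0 \<le> C" using p by (simp add: C_def)
  have "- C * M powr \<gamma> \<le> T / 2 - (8 * sqrt (M * T)) powr q * M / p" if M: "0 < M" and T: "0 \<le> T" for M T
  proof (cases "T \<le> t0 * M powr \<gamma>")
    case False
    then have "0 \<le> T / 2 - (8 * sqrt (M * T)) powr q * M / p" using t0(2)[OF M T] by linarith
    moreover have "- C * M powr \<gamma> \<le> 0" using C by simp
    ultimately show ?thesis by linarith
  next
    case True
    have exps: "1 + q / 2 + \<gamma> * (q / 2) = \<gamma>"
      using q_less by (simp add: field_simps flip: \<gamma>_eq)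
    have "(8 * sqrt (M * T)) powr q * M \<le> (8 * sqrt (M * (t0 * M powr \<gamma>))) powr q * M"
      using M T q_pos True by (intro mult_right_mono powr_mono2) auto
    also have "\<dots> = 8 powr q * (M powr (1 + q / 2) * (t0 powr (q / 2) * M powr (\<gamma> * (q / 2))))"
      using M t0(1) by (subst GN_powr_eq) (auto simp: powr_mult powr_powr)
    also have "\<dots> = 8 powr q * t0 powr (q / 2) * (M powr (1 + q / 2) * M powr (\<gamma> * (q / 2)))" by simp
    also have "M powr (1 + q / 2) * M powr (\<gamma> * (q / 2)) = M powr \<gamma>"
      unfolding powr_add[symmetric] exps ..
    finally have "(8 * sqrt (M * T)) powr q * M / p \<le> C * M powr \<gamma>"
      using p by (simp add: C_def divide_right_mono)
    then show ?thesis using T by simp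
  qed
  then show ?thesis using that by blast
qed

lemma half_powr_le_GN:
  assumes H: "H1_halfline w g"
  shows "half_powr p w \<le> (8 * sqrt (half_mass w * half_mass g)) powr q * half_mass w"
proof -
  have "(w x)\<^sup>2 \<le> 8 * sqrt (half_mass w * half_mass g)" if "0 \<le> x" for x
  proof -
    have "0 \<le> sqrt (half_mass w * half_mass g)"
      using half_mass_nonneg[of w] half_mass_nonneg[of g] by simp
    then show ?thesis using H1_halfline_sq_le[OF H that] by linarith
  qed
  from half_powr_le[OF H p(1) this] show ?thesis by (simp add: q_def)
qed

section \<open>The level of Dirichlet functions and its homogeneity in the mass\<close>

definition Dirichlet :: "(real \<Rightarrow> real) \<Rightarrow> (real \<Rightarrow> real) \<Rightarrow> bool" where
  "Dirichlet w g \<longleftrightarrow> H1_halfline w g \<and> w 0 = 0"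

text \<open>By scaling, the infimum of the energy over Dirichlet functions of mass m is
  - theta * m powr gamma; this is also the infimum over the real line.\<close>
definition "quotients = {- half_energy p w g / half_mass w powr \<gamma> |w g. Dirichlet w g \<and> 0 < half_mass w}"
definition "\<theta> = Sup quotients"

lemma bdd_above_quotients: "bdd_above quotients"
proof -
  obtain C where C: "\<And>M T. 0 < M \<Longrightarrow> 0 \<le> T \<Longrightarrow> - C * M powr \<gamma> \<le> T / 2 - (8 * sqrt (M * T)) powr q * M / p"
    using GN_energy_bound by blast
  show ?thesis
    unfolding quotients_def
  proof (rule bdd_aboveI, safe)
    fix w g assume w: "Dirichlet w g" and M: "0 < half_mass w"
    have "half_powr p w / p \<le> (8 * sqrt (half_mass w * half_mass g)) powr q * half_mass w / p"
      using w half_powr_le_GN[of w g] p by (intro divide_right_mono) (auto simp: Dirichlet_def)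
    then have "- half_energy p w g \<le> C * half_mass w powr \<gamma>"
      using C[OF M half_mass_nonneg[of g]] by (simp add: half_energy_def)
    then show "- half_energy p w g / half_mass w powr \<gamma> \<le> C" using M by (simp add: field_simps)
  qed
qed

lemma Dirichlet_energy_ge:
  assumes D: "Dirichlet w g"
  shows "- \<theta> * half_mass w powr \<gamma> \<le> half_energy p w g"
proof (cases "half_mass w = 0")
  \<comment> \<open>Here 0 powr \<gamma> = 0, and the p-integral vanishes with the mass, so the
    energy is purely kinetic.\<close>
  case True
  then show ?thesis
    using D half_powr_eq_0_if_half_mass_eq_0[of w g p] half_mass_nonneg[of g] p
    by (simp add: half_energy_def Dirichlet_def)
next
  case False
  then have M: "0 < half_mass w" using half_mass_nonneg[of w] by simp
  have "- half_energy p w g / half_mass w powr \<gamma> \<le> \<theta>"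
    unfolding \<theta>_def using D M by (intro cSup_upper bdd_above_quotients) (auto simp: quotients_def)
  then show ?thesis using M by (simp add: field_simps)
qed

text \<open>The dilation sqrt b * w (b * x) keeps the mass, while the kinetic integral scales like
  b^2 and the p-integral like b powr (p / 2 - 1). Since p < 6, the latter wins for small b.\<close>

lemma \<theta>_pos: "0 < \<theta>"
proof -
  obtain w g where w: "H1_halfline w g" "w 0 = 0" "0 < half_mass w" "0 < half_powr p w"
    using H1_halfline_test_function[OF p(1)] .
  let ?T = "half_mass g" and ?P = "half_powr p w"
  \<comment> \<open>With this b the kinetic part of the energy is less than half of the p-part; T +
    1 in place of T keeps b positive also when T = 0.\<close>
  define b where "b = (?P / (p * (?T + 1))) powr (1 / (3 - p / 2))"
  have pos: "0 < ?P / (p * (?T + 1))" using w p half_mass_nonneg[of g] by (intro divide_pos_pos mult_pos_pos) auto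
  then have b: "b > 0" by (metis b_def less_irrefl powr_gt_zero)
  have "b powr (3 - p / 2) = (?P / (p * (?T + 1))) powr ((1 / (3 - p / 2)) * (3 - p / 2))"
    unfolding b_def powr_powr ..
  also have "(1 / (3 - p / 2)) * (3 - p / 2) = 1" using p by simp
  also have "(?P / (p * (?T + 1))) powr 1 = ?P / (p * (?T + 1))" by (rule powr_one) (use pos in simp)
  finally have b3: "b powr (3 - p / 2) = ?P / (p * (?T + 1))" .
  define w' where "w' = (\<lambda>x. sqrt b * w (b * x))"
  define g' where "g' = (\<lambda>x. sqrt b * b * g (b * x))"
  note sc = H1_halfline_scale[OF w(1), of "sqrt b" b, folded w'_def g'_def]
  have H': "H1_halfline w' g'" and M': "half_mass w' = half_mass w" and T': "half_mass g' = b\<^sup>2 * ?T"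
    and P': "half_powr p w' = sqrt b powr p / b * ?P"
    using sc b by (auto simp: power2_eq_square)
  have D: "Dirichlet w' g'" using H' w(2) by (simp add: Dirichlet_def w'_def)
  have "sqrt b powr p / b = b powr (p / 2 - 1)"
    using b by (simp add: powr_half_sqrt[symmetric] powr_powr powr_diff)
  moreover have "b\<^sup>2 = b powr (p / 2 - 1) * b powr (3 - p / 2)"
    using b by (simp add: powr_add[symmetric])
  ultimately have "half_energy p w' g' = b powr (p / 2 - 1) * (b powr (3 - p / 2) * ?T / 2 - ?P / p)"
    unfolding half_energy_def T' P' by (simp add: algebra_simps)
  also have "b powr (3 - p / 2) * ?T / 2 - ?P / p = - (?P / p) * (1 - ?T / (2 * (?T + 1)))"
  proof -
    have "p \<noteq> 0" "?T + 1 \<noteq> 0" using p half_mass_nonneg[of g] by auto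
    then show ?thesis unfolding b3 by (simp add: divide_simps) (simp add: algebra_simps)
  qed
  also have "b powr (p / 2 - 1) * (- (?P / p) * (1 - ?T / (2 * (?T + 1)))) < 0"
  proof -
    have "0 < (?P / p) * (1 - ?T / (2 * (?T + 1)))"
      using p w half_mass_nonneg[of g] by (intro mult_pos_pos) (auto simp: field_simps)
    from mult_pos_pos[OF _ this, of "b powr (p / 2 - 1)"] show ?thesis
      using b by (simp add: powr_gt_zero)
  qed
  finally have "half_energy p w' g' < 0" .
  then have "- \<theta> * half_mass w powr \<gamma> < 0" using Dirichlet_energy_ge[OF D] M' by simp
  then show ?thesis using w(3) by (simp add: zero_less_mult_iff)
qed

lemma Dirichlet_energy_approx:
  assumes \<mu>: "0 < \<mu>" and c: "- \<theta> * \<mu> powr \<gamma> < c"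
  obtains w g where "Dirichlet w g" "half_mass w = \<mu>" "half_energy p w g < c"
proof -
  have "\<exists>x\<in>quotients. - c / \<mu> powr \<gamma> < x"
  proof (subst less_cSup_iff[symmetric])
    show "quotients \<noteq> {}"
      unfolding quotients_def using H1_halfline_test_function[OF p(1)] by (fastforce simp: Dirichlet_def)
    show "- c / \<mu> powr \<gamma> < Sup quotients"
      using c \<mu> by (simp add: \<theta>_def field_simps)
  qed (rule bdd_above_quotients)
  then obtain w g where w: "Dirichlet w g" "0 < half_mass w"
    "- c / \<mu> powr \<gamma> < - half_energy p w g / half_mass w powr \<gamma>"
    by (auto simp: quotients_def)
  define l where "l = \<mu> / half_mass w"
  have l: "l > 0" using \<mu> w by (simp add: l_def)
  \<comment> \<open>a and b solve a^2 / b = l and a^2 * b = l powr \<gamma>. Then a powr p / b = l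
    powr \<gamma> holds by the value of \<gamma>, so the mass is multiplied by l and the energy by l
    powr \<gamma>.\<close>
  define a where "a = l powr ((\<gamma> + 1) / 4)"
  define b where "b = l powr ((\<gamma> - 1) / 2)"
  have ab: "a > 0" "b > 0" using l by (auto simp: a_def b_def)
  have exps: "(\<gamma> + 1) / 4 * 2 - (\<gamma> - 1) / 2 = 1" "(\<gamma> + 1) / 4 * 2 + (\<gamma> - 1) / 2 = \<gamma>"
    "(\<gamma> + 1) / 4 * p - (\<gamma> - 1) / 2 = \<gamma>"
  proof -
    have "\<gamma> * (6 - p) = p + 2" using p by (simp add: \<gamma>_def)
    then show "(\<gamma> + 1) / 4 * p - (\<gamma> - 1) / 2 = \<gamma>" by (simp add: field_simps)
  qed (simp_all add: field_simps)
  have "a\<^sup>2 = a powr 2" using ab by simp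
  also have "\<dots> = l powr ((\<gamma> + 1) / 4 * 2)" unfolding a_def powr_powr ..
  finally have a2: "a\<^sup>2 = l powr ((\<gamma> + 1) / 4 * 2)" .
  have co: "a\<^sup>2 / b = l" "a\<^sup>2 * b = l powr \<gamma>" "a powr p / b = l powr \<gamma>"
    using l unfolding a2 unfolding a_def b_def powr_powr powr_add[symmetric] powr_diff[symmetric] exps by auto
  define w' where "w' = (\<lambda>x. a * w (b * x))"
  define g' where "g' = (\<lambda>x. a * b * g (b * x))"
  have w1: "H1_halfline w g" "w 0 = 0" using w(1) by (auto simp: Dirichlet_def)
  note sc = H1_halfline_scale[OF w1(1) ab, folded w'_def g'_def, unfolded co]
  have "half_energy p w' g' = l powr \<gamma> * half_energy p w g"
    unfolding half_energy_def sc co by (simp add: algebra_simps)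
  also have "\<dots> < c"
    using w(2,3) \<mu> by (simp add: l_def powr_divide field_simps)
  finally have "half_energy p w' g' < c" .
  moreover have "half_mass w' = \<mu>" unfolding sc l_def using w(2) by simp
  moreover have "Dirichlet w' g'" using sc(1) w1(2) by (simp add: Dirichlet_def w'_def)
  ultimately show ?thesis using that by blast
qed

end

subsection \<open>Nonexistence of extremals on the half-line\<close>

lemma
  assumes H: "H1_halfline w g" and b: "0 \<le> b"
  shows H1_halfline_shift: "H1_halfline (\<lambda>x. w (b + x)) (\<lambda>x. g (b + x))"
    and half_mass_split: "half_mass w = set_lebesgue_integral lborel {0..b} (\<lambda>t. (w t)\<^sup>2) + half_mass (\<lambda>x. w (b + x))"
    and half_mass_split_deriv: "half_mass g = set_lebesgue_integral lborel {0..b} (\<lambda>t. (g t)\<^sup>2) + half_mass (\<lambda>x. g (b + x))"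
    and half_powr_split: "2 < p \<Longrightarrow> half_powr p w = set_lebesgue_integral lborel {0..b} (\<lambda>t. \<bar>w t\<bar> powr p) + half_powr p (\<lambda>x. w (b + x))"
proof -
  have pre: "{x. b + 1 * x \<in> {b..}} = {0..}" "{x. b + 1 * x \<in> {b..b+y}} = {0..y}" for y by auto
  note int = set_integrable_lborel_affine_iff[of 1 b "{b..}", unfolded pre, simplified]
  note LINT = set_integral_lborel_affine[of 1 b "{b..}", unfolded pre, simplified]
  note intI = set_integrable_lborel_affine_iff[of 1 b "{b..b+y}" for y, unfolded pre, simplified]
  note LINTI = set_integral_lborel_affine[of 1 b "{b..b+y}" for y, unfolded pre, simplified]
  have split: "set_lebesgue_integral lborel {0..} f = set_lebesgue_integral lborel {0..b} f + set_lebesgue_integral lborel {0..} (\<lambda>x. f (b + x))"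
    if f: "set_integrable lborel {0..} f" for f :: "real \<Rightarrow> real"
  proof -
    have U: "{0..b} \<union> {b..} = {0..}" using b by auto
    have "AE x in lborel. \<not> (x \<in> {0..b} \<and> x \<in> {b..})"
      using AE_lborel_singleton[of b] by eventually_elim auto
    moreover have "set_integrable lborel {0..b} f" "set_integrable lborel {b..} f"
      using b by (auto intro!: set_integrable_subset[OF f])
    ultimately have "set_lebesgue_integral lborel ({0..b} \<union> {b..}) f =
        set_lebesgue_integral lborel {0..b} f + set_lebesgue_integral lborel {b..} f"
      by (intro set_integral_Un_AE) auto
    then show ?thesis unfolding U LINT .
  qed
  have sub: "set_integrable lborel {b..} f" if "set_integrable lborel {0..} f" for f :: "real \<Rightarrow> real"
    using b by (intro set_integrable_subset[OF that]) auto
  show "H1_halfline (\<lambda>x. w (b + x)) (\<lambda>x. g (b + x))"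
    unfolding H1_halfline_def
  proof (intro conjI allI impI)
    fix x :: real assume x: "0 \<le> x"
    have I: "set_integrable lborel {0..b+x} g" using H1_halfline_D(1)[OF H] x b by simp
    show "set_integrable lborel {0..x} (\<lambda>x. g (b + x))"
      unfolding intI using b by (intro set_integrable_subset[OF I]) auto
    show "w (b + x) = w (b + 0) + set_lebesgue_integral lborel {0..x} (\<lambda>x. g (b + x))"
      unfolding LINTI using H1_interval_diff[OF H1_halfline_restrict[OF H, of "b+x"], of b "b+x"] b x by simp
  next
    show "set_integrable lborel {0..} (\<lambda>t. (g (b + t))\<^sup>2)"
      using sub[OF H1_halfline_D(2)[OF H]] int[of "\<lambda>t. (g t)\<^sup>2"] by simp
    show "set_integrable lborel {0..} (\<lambda>t. (w (b + t))\<^sup>2)"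
      using sub[OF H1_halfline_D(3)[OF H]] int[of "\<lambda>t. (w t)\<^sup>2"] by simp
  qed
  show "half_mass w = set_lebesgue_integral lborel {0..b} (\<lambda>t. (w t)\<^sup>2) + half_mass (\<lambda>x. w (b + x))"
    unfolding half_mass_def by (rule split[OF H1_halfline_D(3)[OF H]])
  show "half_mass g = set_lebesgue_integral lborel {0..b} (\<lambda>t. (g t)\<^sup>2) + half_mass (\<lambda>x. g (b + x))"
    unfolding half_mass_def by (rule split[OF H1_halfline_D(2)[OF H]])
  show "half_powr p w = set_lebesgue_integral lborel {0..b} (\<lambda>t. \<bar>w t\<bar> powr p) + half_powr p (\<lambda>x. w (b + x))" if "2 < p"
    unfolding half_powr_def by (rule split[OF H1_halfline_integrable_powr[OF H that H1_halfline_sq_le[OF H]]])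
qed

lemma
  assumes H: "H1_interval b w g" and b: "0 \<le> b"
  shows H1_interval_stretch: "H1_interval (2 * b) (\<lambda>x. w (1/2 * x)) (\<lambda>x. 1/2 * g (1/2 * x))"
    and stretch_integral: "\<And>f::real \<Rightarrow> real. set_lebesgue_integral lborel {0..2 * b} (\<lambda>x. f (1/2 * x)) = 2 * set_lebesgue_integral lborel {0..b} f"
proof -
  have pre: "{x::real. 0 + 1/2 * x \<in> {0..1/2 * y}} = {0..y}" for y :: real
    by (rule dilation_preimages) simp
  note int = set_integrable_lborel_affine_iff[of "1/2" 0 "{0..1/2 * y}" for y, unfolded pre, simplified]
  note LINT = set_integral_lborel_affine[of "1/2" 0 "{0..1/2 * y}" for y, unfolded pre, simplified]
  show st: "set_lebesgue_integral lborel {0..2 * b} (\<lambda>x. f (1/2 * x)) = 2 * set_lebesgue_integral lborel {0..b} f"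
    for f :: "real \<Rightarrow> real"
    using LINT[of "2 * b" f] by (simp add: mult.commute)
  show "H1_interval (2 * b) (\<lambda>x. w (1/2 * x)) (\<lambda>x. 1/2 * g (1/2 * x))"
    unfolding H1_interval_def
  proof (intro conjI ballI)
    show "set_integrable lborel {0..2 * b} (\<lambda>x. 1/2 * g (1/2 * x))"
      using int[of "2 * b" g] H1_interval_D(1)[OF H] by (intro set_integrable_mult_right) simp
    show "set_integrable lborel {0..2 * b} (\<lambda>x. (1/2 * g (1/2 * x))\<^sup>2)"
      unfolding power_mult_distrib
      using int[of "2 * b" "\<lambda>x. (g x)\<^sup>2"] H1_interval_D(2)[OF H] by (intro set_integrable_mult_right) simp
    fix x assume x: "x \<in> {0..2 * b}"
    have "set_lebesgue_integral lborel {0..x} (\<lambda>x. 1/2 * g (1/2 * x)) = set_lebesgue_integral lborel {0..x/2} g"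
      using LINT[of x g] by (simp add: mult.commute)
    then show "w (1/2 * x) = w (1/2 * 0) + set_lebesgue_integral lborel {0..x} (\<lambda>x. 1/2 * g (1/2 * x))"
      using H1_interval_D(3)[OF H, of "x/2"] x by simp
  qed
qed

context subcritical
begin

text \<open>The derivative of x powr \<gamma> at 2 * \<mu> is
  \<open>c\<^sub>\<gamma> * \<mu> powr (\<gamma> - 1)\<close>.\<close>

definition "c\<^sub>\<gamma> = \<gamma> * 2 powr (\<gamma> - 1)"

lemma c\<^sub>\<gamma>_ge_1: "1 \<le> c\<^sub>\<gamma>"
proof -
  have "1 * 1 \<le> \<gamma> * 2 powr (\<gamma> - 1)"
    using \<gamma>_gt_1 by (intro mult_mono ge_one_powr_ge_zero) auto
  then show ?thesis by (simp add: c\<^sub>\<gamma>_def)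
qed

text \<open>This is the price of replacing the mass Q by the mass r. If r <= Q, the new mass y is at
  most \<mu> and y powr \<gamma> <= \<mu> powr (\<gamma> - 1) * y. Otherwise the mean value theorem
  is used inside [\<mu>, 2 * \<mu>], where r <= \<mu> keeps the new mass.\<close>

lemma powr_\<gamma>_le:
  assumes \<mu>: "0 < \<mu>" and Q: "0 \<le> Q" "Q \<le> \<mu>" and r: "0 \<le> r" "r \<le> \<mu>"
  shows "(\<mu> - Q + r) powr \<gamma> \<le> \<mu> powr \<gamma> + \<mu> powr (\<gamma> - 1) * (c\<^sub>\<gamma> * r - Q)"
proof -
  have \<mu>\<gamma>: "\<mu> powr (\<gamma> - 1) * \<mu> = \<mu> powr \<gamma>"
    using \<mu> by (simp add: powr_mult_base mult.commute)
  show ?thesis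
  proof (cases "r \<le> Q")
    case True
    define y where "y = \<mu> - Q + r"
    have y: "0 \<le> y" "y \<le> \<mu>" using True Q r by (auto simp: y_def)
    have "y powr \<gamma> = y powr (\<gamma> - 1) * y"
      using y by (cases "y = 0") (auto simp: powr_mult_base mult.commute)
    also have "\<dots> \<le> \<mu> powr (\<gamma> - 1) * y"
      using y \<gamma>_gt_1 by (intro mult_right_mono powr_mono2) auto
    also have "\<dots> = \<mu> powr \<gamma> + \<mu> powr (\<gamma> - 1) * (r - Q)"
      by (simp add: y_def algebra_simps flip: \<mu>\<gamma>)
    also have "\<dots> \<le> \<mu> powr \<gamma> + \<mu> powr (\<gamma> - 1) * (c\<^sub>\<gamma> * r - Q)"
      using c\<^sub>\<gamma>_ge_1 r mult_right_mono[of 1 "c\<^sub>\<gamma>" r] by (intro add_left_mono mult_left_mono) auto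
    finally show ?thesis by (simp add: y_def)
  next
    case False
    define h where "h = r - Q"
    have h: "0 < h" "h \<le> \<mu>" using False Q r by (auto simp: h_def)
    obtain z where z: "\<mu> < z" "z < \<mu> + h"
      "(\<mu> + h) powr \<gamma> - \<mu> powr \<gamma> = (\<mu> + h - \<mu>) * (\<gamma> * z powr (\<gamma> - 1))"
      using MVT2[of \<mu> "\<mu> + h" "\<lambda>x. x powr \<gamma>" "\<lambda>x. \<gamma> * x powr (\<gamma> - 1)"] h \<mu>
        has_real_derivative_powr[of _ \<gamma>] by auto
    have "(\<mu> + h) powr \<gamma> \<le> \<mu> powr \<gamma> + h * (\<gamma> * (2 * \<mu>) powr (\<gamma> - 1))"
    proof -
      have "z powr (\<gamma> - 1) \<le> (2 * \<mu>) powr (\<gamma> - 1)"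
        using z h \<mu> \<gamma>_gt_1 by (intro powr_mono2) auto
      then have "h * (\<gamma> * z powr (\<gamma> - 1)) \<le> h * (\<gamma> * (2 * \<mu>) powr (\<gamma> - 1))"
        using h \<gamma>_gt_1 by (intro mult_left_mono) auto
      then show ?thesis using z(3) by simp
    qed
    also have "h * (\<gamma> * (2 * \<mu>) powr (\<gamma> - 1)) = \<mu> powr (\<gamma> - 1) * (c\<^sub>\<gamma> * r - c\<^sub>\<gamma> * Q)"
      using \<mu> by (simp add: powr_mult c\<^sub>\<gamma>_def h_def algebra_simps)
    also have "\<dots> \<le> \<mu> powr (\<gamma> - 1) * (c\<^sub>\<gamma> * r - Q)"
      using c\<^sub>\<gamma>_ge_1 Q mult_right_mono[of 1 "c\<^sub>\<gamma>" Q] by (intro mult_left_mono) auto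
    finally show ?thesis by (simp add: h_def algebra_simps)
  qed
qed

text \<open>Prepending a linear ramp of length 1/s turns w into a Dirichlet function.\<close>
lemma half_energy_ge:
  assumes H: "H1_halfline w h" and s: "0 < s" and \<mu>: "0 < \<mu>" and Q: "0 \<le> Q" "half_mass w = \<mu> - Q"
    and r: "(w 0)\<^sup>2 / s \<le> \<mu>"
  shows "- \<theta> * (\<mu> powr \<gamma> + \<mu> powr (\<gamma> - 1) * (c\<^sub>\<gamma> * ((w 0)\<^sup>2 / s) - Q)) - s * (w 0)\<^sup>2 / 2 \<le> half_energy p w h"
proof -
  let ?d = "w 0"
  \<comment> \<open>The ramp has kinetic integral s * (w 0)^2 and mass at most (w 0)^2 / s. In the
    application s = \<mu> powr \<beta>, so \<mu> powr (\<gamma> - 1) = s^2 and both costs are of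
    order s * (w 0)^2.\<close>
  define v where "v = (\<lambda>x. 0 + (?d * s) * x)"
  have s1: "0 \<le> 1 / s" using s by simp
  have v: "H1_interval (1 / s) v (\<lambda>x. ?d * s)" unfolding v_def by (rule H1_interval_affine)
  have eq: "v (1 / s) = w 0" using s by (simp add: v_def)
  note G = H1_halfline_glue[OF s1 v H eq] half_mass_glue[OF s1 v H eq] half_mass_glue_deriv[OF s1 v H eq]
    half_powr_glue[OF s1 v H eq p(1)]
  define m where "m = set_lebesgue_integral lborel {0..1 / s} (\<lambda>t. (v t)\<^sup>2)"
  have m0: "0 \<le> m" unfolding m_def by (rule set_integral_nonneg') simp
  have "m \<le> set_lebesgue_integral lborel {0..1 / s} (\<lambda>t. ?d\<^sup>2)"
    unfolding m_def
  proof (intro set_integral_mono H1_interval_integrable_square[OF v])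
    fix t assume t: "t \<in> {0..1 / s}"
    have "(s * t)\<^sup>2 \<le> 1\<^sup>2" using t s by (intro power_mono) (auto simp: field_simps)
    then have "?d\<^sup>2 * (s * t)\<^sup>2 \<le> ?d\<^sup>2 * 1" by (intro mult_left_mono) auto
    then show "(v t)\<^sup>2 \<le> ?d\<^sup>2" by (simp add: v_def power_mult_distrib mult_ac)
  qed simp
  then have m1: "m \<le> ?d\<^sup>2 / s" using s1 by (simp add: set_integral_Icc_const)
  have Q\<mu>: "Q \<le> \<mu>" using Q half_mass_nonneg[of w] by simp
  have "Dirichlet (glue (1 / s) v w) (glue (1 / s) (\<lambda>x. ?d * s) h)"
    using G(1) s1 by (simp add: Dirichlet_def glue_def v_def)
  from Dirichlet_energy_ge[OF this]
  have "- \<theta> * (\<mu> - Q + m) powr \<gamma> \<le> half_energy p (glue (1 / s) v w) (glue (1 / s) (\<lambda>x. ?d * s) h)"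
    using G(2) Q by (simp add: m_def add.commute)
  also have "\<dots> \<le> s * ?d\<^sup>2 / 2 + half_energy p w h"
  proof -
    have kin: "set_lebesgue_integral lborel {0..1 / s} (\<lambda>t. (?d * s)\<^sup>2) = s * ?d\<^sup>2"
      using s by (simp only: set_integral_Icc_const[OF s1]) (simp add: power2_eq_square)
    have "0 \<le> set_lebesgue_integral lborel {0..1 / s} (\<lambda>t. \<bar>v t\<bar> powr p)"
      by (rule set_integral_nonneg') simp
    then have "0 \<le> 1 / p * set_lebesgue_integral lborel {0..1 / s} (\<lambda>t. \<bar>v t\<bar> powr p)"
      using p by (intro mult_nonneg_nonneg) auto
    then show ?thesis
      unfolding half_energy_def G kin distrib_left by linarith
  qed
  finally have 1: "- \<theta> * (\<mu> - Q + m) powr \<gamma> - s * ?d\<^sup>2 / 2 \<le> half_energy p w h" by simp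
  have "(\<mu> - Q + m) powr \<gamma> \<le> \<mu> powr \<gamma> + \<mu> powr (\<gamma> - 1) * (c\<^sub>\<gamma> * m - Q)"
    using m0 m1 r Q Q\<mu> \<mu> by (intro powr_\<gamma>_le) auto
  also have "\<dots> \<le> \<mu> powr \<gamma> + \<mu> powr (\<gamma> - 1) * (c\<^sub>\<gamma> * (?d\<^sup>2 / s) - Q)"
    using m1 c\<^sub>\<gamma>_ge_1 by (intro add_left_mono mult_left_mono diff_right_mono) auto
  finally have "\<theta> * (\<mu> - Q + m) powr \<gamma> \<le> \<theta> * (\<mu> powr \<gamma> + \<mu> powr (\<gamma> - 1) * (c\<^sub>\<gamma> * (?d\<^sup>2 / s) - Q))"
    using \<theta>_pos by (intro mult_left_mono) auto
  then show ?thesis using 1 by linarith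
qed

text \<open>Stretching the part of an extremal on [0, b] by the factor 2 controls its kinetic energy there
  by its mass there, which forces it to vanish step by step, starting from 0.\<close>
lemma Dirichlet_energy_gt:
  assumes D: "Dirichlet w g" and \<mu>: "half_mass w = \<mu>" "0 < \<mu>"
  shows "- \<theta> * \<mu> powr \<gamma> < half_energy p w g"
proof (rule ccontr)
  assume "\<not> ?thesis"
  then have E: "half_energy p w g \<le> - \<theta> * \<mu> powr \<gamma>" by simp
  have H: "H1_halfline w g" and w0: "w 0 = 0" using D by (auto simp: Dirichlet_def)
  let ?M = "\<lambda>b. set_lebesgue_integral lborel {0..b} (\<lambda>t. (w t)\<^sup>2)"
  let ?T = "\<lambda>b. set_lebesgue_integral lborel {0..b} (\<lambda>t. (g t)\<^sup>2)"
  let ?P = "\<lambda>b. set_lebesgue_integral lborel {0..b} (\<lambda>t. \<bar>w t\<bar> powr p)"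
  define C where "C = 4 * \<theta> * (\<mu> powr (\<gamma> - 1) * c\<^sub>\<gamma>)"
  have C: "0 < C" unfolding C_def using \<theta>_pos \<mu>(2) c\<^sub>\<gamma>_ge_1 by (intro mult_pos_pos) auto
  have key: "?T b \<le> C * ?M b" if b: "0 \<le> b" for b
  proof -
    note I = H1_halfline_restrict[OF H b]
    let ?v = "\<lambda>x. w (1/2 * x)" and ?k = "\<lambda>x. 1/2 * g (1/2 * x)"
    let ?w = "\<lambda>x. w (b + x)" and ?g = "\<lambda>x. g (b + x)"
    have b2: "0 \<le> 2 * b" and eq: "?v (2 * b) = ?w 0" using b by auto
    note gl = b2 H1_interval_stretch[OF I b] H1_halfline_shift[OF H b] eq
    note G = H1_halfline_glue[OF gl] half_mass_glue[OF gl] half_mass_glue_deriv[OF gl] half_powr_glue[OF gl p(1)]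
    note S = half_mass_split[OF H b] half_mass_split_deriv[OF H b] half_powr_split[OF H b p(1)]
    have st: "set_lebesgue_integral lborel {0..2 * b} (\<lambda>t. (w (1/2 * t))\<^sup>2) = 2 * ?M b"
      "set_lebesgue_integral lborel {0..2 * b} (\<lambda>t. (1/2 * g (1/2 * t))\<^sup>2) = ?T b / 2"
      "set_lebesgue_integral lborel {0..2 * b} (\<lambda>t. \<bar>w (1/2 * t)\<bar> powr p) = 2 * ?P b"
      using stretch_integral[OF I b, of "\<lambda>t. (w t)\<^sup>2"] stretch_integral[OF I b, of "\<lambda>t. (1/2 * g t)\<^sup>2"]
        stretch_integral[OF I b, of "\<lambda>t. \<bar>w t\<bar> powr p"] by (simp_all add: power_mult_distrib power_divide)
    have M0: "0 \<le> ?M b" "0 \<le> ?P b" by (rule set_integral_nonneg', simp)+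
    have M\<mu>: "?M b \<le> \<mu>" using S(1) half_mass_nonneg[of ?w] \<mu> by simp
    have "Dirichlet (glue (2 * b) ?v ?w) (glue (2 * b) ?k ?g)"
      using G(1) b w0 by (simp add: Dirichlet_def glue_def)
    from Dirichlet_energy_ge[OF this]
    have "- \<theta> * (\<mu> + ?M b) powr \<gamma> \<le> half_energy p (glue (2 * b) ?v ?w) (glue (2 * b) ?k ?g)"
      using S(1) \<mu>(1) unfolding G(2) st by (simp add: add_ac)
    \<comment> \<open>The stretch halves the kinetic integral and doubles the mass and the
      p-integral on [0, b]: T / 2 becomes T / 4 and - P / p becomes - 2 * P / p, so both changes
      lower the energy.\<close>
    also have "\<dots> = half_energy p w g - ?T b / 4 - ?P b / p"
      unfolding half_energy_def G st S by (simp add: add_divide_distrib algebra_simps)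
    also have "\<dots> \<le> - \<theta> * \<mu> powr \<gamma> - ?T b / 4"
      using E divide_nonneg_pos[OF M0(2), of p] p by linarith
    finally have "?T b / 4 \<le> \<theta> * ((\<mu> + ?M b) powr \<gamma> - \<mu> powr \<gamma>)" by (simp add: algebra_simps)
    also have "\<dots> \<le> \<theta> * (\<mu> powr (\<gamma> - 1) * (c\<^sub>\<gamma> * ?M b))"
      using powr_\<gamma>_le[OF \<mu>(2), of 0 "?M b"] M0 M\<mu> \<mu>(2) \<theta>_pos by (intro mult_left_mono) auto
    finally show ?thesis by (simp add: C_def)
  qed
  \<comment> \<open>h^2 * C = 1 / 2: if w vanishes up to n * h, the mass up to (n + 1) * h is at
    most h^2 times the kinetic integral there, hence at most half of itself.\<close>
  define h where "h = sqrt (1 / (2 * C))"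
  have h: "0 < h" "h * h * C = 1 / 2" using C by (auto simp: h_def)
  have "\<forall>x\<in>{0..real n * h}. w x = 0" for n
  proof (induction n)
    case 0
    then show ?case using w0 by simp
  next
    case (Suc n)
    let ?a = "real n * h" and ?b = "real (Suc n) * h"
    have ab: "0 \<le> ?a" "?a \<le> ?b" "?b - ?a = h" "0 \<le> ?b" using h by (auto simp: algebra_simps)
    have T0: "0 \<le> ?T ?b" by (rule set_integral_nonneg') simp
    have wx: "(w x)\<^sup>2 \<le> h * ?T ?b" if x: "?a \<le> x" "x \<le> ?b" for x
    proof -
      have "(w x - w ?a)\<^sup>2 \<le> (x - ?a) * set_lebesgue_integral lborel {?a..x} (\<lambda>t. (g t)\<^sup>2)"
        using x ab by (intro H1_interval_diff_sq_le[OF H1_halfline_restrict[OF H ab(4)]]) auto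
      also have "\<dots> \<le> h * ?T ?b"
        using x ab
        by (intro mult_mono set_integral_mono_set[OF H1_interval_D(2)[OF H1_halfline_restrict[OF H ab(4)]]]
            set_integral_nonneg') auto
      finally show ?thesis using Suc ab by simp
    qed
    have Iw: "set_integrable lborel {0..?b} (\<lambda>t. (w t)\<^sup>2)"
      by (rule H1_interval_integrable_square[OF H1_halfline_restrict[OF H ab(4)]])
    have "?M ?b = ?M ?a + set_lebesgue_integral lborel {?a..?b} (\<lambda>t. (w t)\<^sup>2)"
      by (rule lborel_set_integral_Icc_split[OF ab(1,2) Iw])
    also have "?M ?a = set_lebesgue_integral lborel {0..?a} (\<lambda>t. 0)"
      using Suc by (intro set_lebesgue_integral_cong) auto
    also have "set_lebesgue_integral lborel {?a..?b} (\<lambda>t. (w t)\<^sup>2) \<le> set_lebesgue_integral lborel {?a..?b} (\<lambda>t. h * ?T ?b)"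
      using ab wx by (intro set_integral_mono set_integrable_subset[OF Iw]) auto
    also have "\<dots> = h * ?T ?b * h"
      using ab by (subst set_integral_Icc_const) auto
    finally have "?M ?b \<le> h * h * ?T ?b" by (simp add: mult_ac)
    moreover have "h * h * ?T ?b \<le> h * h * (C * ?M ?b)"
      using key[OF ab(4)] h by (intro mult_left_mono) auto
    ultimately have "?M ?b \<le> (h * h * C) * ?M ?b" by simp
    then have "?M ?b \<le> 0" unfolding h(2) by simp
    then have "C * ?M ?b \<le> 0" using C by (simp add: mult_le_0_iff)
    then have "?T ?b \<le> 0" using key[OF ab(4)] by linarith
    then have "h * ?T ?b \<le> 0" using h by (simp add: mult_le_0_iff)
    then have w2: "w x = 0" if "?a \<le> x" "x \<le> ?b" for x
      using wx[OF that] by (metis order_trans power2_less_eq_zero_iff)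
    show ?case
    proof
      fix x assume "x \<in> {0..?b}"
      then show "w x = 0" using Suc w2[of x] by (cases "x \<le> ?a") auto
    qed
  qed
  then have w_eq_0: "w x = 0" if "0 \<le> x" for x
    using that h reals_Archimedean3[of h] by (metis atLeastAtMost_iff less_imp_le)
  have "half_mass w = set_lebesgue_integral lborel {0..} (\<lambda>t::real. 0)"
    unfolding half_mass_def by (intro set_lebesgue_integral_cong) (auto simp: w_eq_0)
  then show False using \<mu> by simp
qed

end

subsection \<open>Nonexistence of ground states\<close>

context subcritical
begin

definition "\<beta> = (p - 2) / (6 - p)"

lemma \<beta>_\<gamma>: "\<gamma> - 1 = 2 * \<beta>" and \<beta>_q: "(\<beta> + 1) * q = 2 * \<beta>"
  using p by (auto simp: \<beta>_def \<gamma>_def q_def field_simps)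

lemma ground_state_energy_le:
  assumes "0 < \<mu>" and H: "H1_graph G u w g h"
    and min: "\<And>v z k l. H1_graph G v z k l \<Longrightarrow> graph_mass G v z = \<mu> \<Longrightarrow>
      graph_energy p G u w g h \<le> graph_energy p G v z k l"
  shows "graph_energy p G u w g h \<le> - \<theta> * \<mu> powr \<gamma>"
proof (rule ccontr)
  assume "\<not> ?thesis"
  then obtain z l where z: "Dirichlet z l" "half_mass z = \<mu>" "half_energy p z l < graph_energy p G u w g h"
    using Dirichlet_energy_approx[of \<mu> "graph_energy p G u w g h"] assms(1) by auto
  have "H1_graph G (\<lambda>_ _. 0) z (\<lambda>_ _. 0) l"
    using z(1) by (auto simp: H1_graph_def Dirichlet_def H1_interval_def set_integrable_def intro!: exI[of _ "\<lambda>_. 0"])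
  moreover have "graph_mass G (\<lambda>_ _. 0) z = \<mu>"
    using z(2) by (simp add: graph_mass_def half_mass_def)
  ultimately have "graph_energy p G u w g h \<le> graph_energy p G (\<lambda>_ _. 0) z (\<lambda>_ _. 0) l" by (rule min)
  also have "\<dots> = half_energy p z l"
    by (simp add: graph_energy_def half_energy_def half_mass_def half_powr_def)
  finally show False using z(3) by simp
qed

lemma no_ground_state:
  obtains \<epsilon> where "0 < \<epsilon>"
    "\<And>G \<mu>. one_halfline_graph G \<Longrightarrow> 0 < \<mu> \<Longrightarrow> \<mu> powr \<beta> * core_diam G < \<epsilon> \<Longrightarrow>
      1 / (\<mu> powr \<beta> * core_length G) < \<epsilon> \<Longrightarrow> \<not> has_ground_state p G \<mu>"
proof -
  obtain t0 where t0: "0 < t0" "\<And>M T. 0 < M \<Longrightarrow> 0 \<le> T \<Longrightarrow>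
    T / 2 \<le> (8 * sqrt (M * T)) powr q * M / p \<Longrightarrow> T \<le> t0 * M powr \<gamma>"
    using kinetic_bound by blast
  \<comment> \<open>If u^2 <= \<eta> * s * \<mu> on the core, the p-term there is at most \<theta> /
    2 * s^2 * Mass, half of the gain.\<close>
  define \<eta> where "\<eta> = (p * \<theta> / 2) powr (1 / q)"
  have \<eta>: "0 < \<eta>" "\<eta> powr q / p = \<theta> / 2"
    using p \<theta>_pos q_pos by (auto simp: \<eta>_def powr_powr)
  \<comment> \<open>D / 16 is the price of the ramp in units of s * (w 0)^2; the 16 cancels against
    the bound 16 * \<epsilon> * X for this quantity.\<close>
  define D where "D = 16 * (\<theta> * c\<^sub>\<gamma> + 1/2)"
  have D: "0 < D" using \<theta>_pos c\<^sub>\<gamma>_ge_1 by (simp add: D_def add_pos_pos)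
  \<comment> \<open>In this order the entries ensure that the ramp has mass at most \<mu>, that u^2
    on the core meets the bound set by \<eta>, and that the two parts of the ramp's price are at
    most Kinetic / 4 and \<theta> / 4 * s^2 * Mass.\<close>
  define \<epsilon> where "\<epsilon> = Min {1 / (16 * (1 + t0)), \<eta> / (48 * (1 + t0)), 1 / (4 * D), \<theta> / (4 * D)}"
  have \<epsilon>: "0 < \<epsilon>" using t0(1) \<eta>(1) D \<theta>_pos by (simp add: \<epsilon>_def)
  have "\<epsilon> \<le> 1 / (16 * (1 + t0))" "\<epsilon> \<le> \<eta> / (48 * (1 + t0))" "\<epsilon> \<le> 1 / (4 * D)" "\<epsilon> \<le> \<theta> / (4 * D)"
    unfolding \<epsilon>_def by (rule Min_le; simp)+
  then have \<epsilon>_le: "16 * \<epsilon> * (1 + t0) \<le> 1" "48 * \<epsilon> * (1 + t0) \<le> \<eta>" "\<epsilon> * D \<le> 1 / 4" "\<epsilon> * D \<le> \<theta> / 4"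
    using t0(1) D by (simp_all add: field_simps)
  have "\<not> has_ground_state p G \<mu>"
    if G: "one_halfline_graph G" and \<mu>: "0 < \<mu>" and diam: "\<mu> powr \<beta> * core_diam G < \<epsilon>"
      and length: "1 / (\<mu> powr \<beta> * core_length G) < \<epsilon>" for G \<mu>
  proof
    assume "has_ground_state p G \<mu>"
    then obtain u w g h where H: "H1_graph G u w g h" and mass_eq: "graph_mass G u w = \<mu>"
      and min: "\<And>v z k l. H1_graph G v z k l \<Longrightarrow> graph_mass G v z = \<mu> \<Longrightarrow>
        graph_energy p G u w g h \<le> graph_energy p G v z k l"
      unfolding has_ground_state_def by blast
    obtain \<phi> where \<phi>: "\<And>e. e \<in> edges G \<Longrightarrow> u e 0 = \<phi> (src G e) \<and> u e (len G e) = \<phi> (tgt G e)"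
      and w0: "w 0 = \<phi> (att G)" and Hw: "H1_halfline w h"
      and Hu: "\<And>e. e \<in> edges G \<Longrightarrow> H1_interval (len G e) (u e) (g e)"
      using H unfolding H1_graph_def by blast
    interpret core_function G u g \<phi>
      by unfold_locales (use G \<phi> Hu in auto)
    \<comment> \<open>The scales at mass \<mu>: 1 / s is a length, s * \<mu> a squared height, and
      s^2 * \<mu> = \<mu> powr \<gamma> an energy.\<close>
    define s where "s = \<mu> powr \<beta>"
    have s: "0 < s" using \<mu> by (simp add: s_def)
    have s2: "\<mu> powr (\<gamma> - 1) = s\<^sup>2" unfolding \<beta>_\<gamma> s_def power2_eq_square by (simp flip: powr_add)
    have s2\<mu>: "\<mu> powr \<gamma> = s\<^sup>2 * \<mu>" using \<mu> by (simp add: powr_mult_base mult.commute flip: s2)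
    have s\<mu>: "(s * \<mu>) powr q = s\<^sup>2"
    proof -
      have "s * \<mu> = \<mu> powr (\<beta> + 1)" using \<mu> by (simp add: s_def powr_add)
      then show ?thesis by (simp add: powr_powr \<beta>_q \<beta>_\<gamma> flip: s2)
    qed
    let ?d = "core_diam G" and ?l = "core_length G" and ?\<delta> = "\<phi> (att G)"
    let ?PK = "\<Sum>e\<in>edges G. set_lebesgue_integral lborel {0..len G e} (\<lambda>t. \<bar>u e t\<bar> powr p)"
    define E where "E = graph_energy p G u w g h"
    have mass: "half_mass w = \<mu> - Mass"
      using mass_eq unfolding graph_mass_def half_mass_def mass_def by simp
    have Mass_le: "Mass \<le> \<mu>" using mass half_mass_nonneg[of w] by simp
    have E_eq: "E = Kinetic / 2 - ?PK / p + half_energy p w h"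
      unfolding E_def graph_energy_def half_energy_def half_mass_def half_powr_def kinetic_def
      by (simp add: add_divide_distrib algebra_simps)
    have E_le: "E \<le> - \<theta> * \<mu> powr \<gamma>"
      unfolding E_def by (rule ground_state_energy_le[OF \<mu> H min])
    define T where "T = Kinetic + half_mass h"
    have T: "Kinetic \<le> T" "half_mass h \<le> T" "0 \<le> T"
      using Kinetic_nonneg half_mass_nonneg[of h] by (auto simp: T_def)
    \<comment> \<open>As E <= 0, the kinetic energy is controlled by the p-term, uniformly in G. On
      the half-line w^2 <= 4 * sqrt (\<mu> * T), and the variation over the core adds at most as
      much again.\<close>
    have T_le: "T \<le> t0 * \<mu> powr \<gamma>"
    proof (rule t0(2)[OF \<mu> T(3)])
      let ?B = "8 * sqrt (\<mu> * T)"
      have "sqrt (half_mass w * half_mass h) \<le> sqrt (\<mu> * T)"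
        using mass Mass_nonneg T \<mu> half_mass_nonneg[of h] half_mass_nonneg[of w]
        by (intro real_sqrt_le_mono mult_mono) auto
      then have w4: "(w x)\<^sup>2 \<le> 4 * sqrt (\<mu> * T)" if "0 \<le> x" for x
        using H1_halfline_sq_le[OF Hw that] by linarith
      have pos: "0 \<le> sqrt (\<mu> * T)" using T \<mu> by simp
      have "half_powr p w \<le> ?B powr q * half_mass w"
      proof -
        have "(w x)\<^sup>2 \<le> ?B" if "0 \<le> x" for x using w4[OF that] pos by linarith
        from half_powr_le[OF Hw p(1) this] show ?thesis by (simp add: q_def)
      qed
      moreover have "?PK \<le> ?B powr q * Mass"
        unfolding q_def
      proof (rule core_powr_integral_le[OF p(1)])
        fix e x assume "e \<in> edges G" "0 \<le> x" "x \<le> len G e"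
        then have "\<bar>(u e x)\<^sup>2 - ?\<delta>\<^sup>2\<bar> \<le> 4 * sqrt (Mass * Kinetic)" by (rule core_diff_squares_le)
        moreover have "sqrt (Mass * Kinetic) \<le> sqrt (\<mu> * T)"
          using Mass_le T Mass_nonneg Kinetic_nonneg by (intro real_sqrt_le_mono mult_mono) auto
        moreover have "?\<delta>\<^sup>2 \<le> 4 * sqrt (\<mu> * T)" using w4[of 0] w0 by simp
        ultimately show "(u e x)\<^sup>2 \<le> ?B" by linarith
      qed
      ultimately have "?PK + half_powr p w \<le> ?B powr q * Mass + ?B powr q * half_mass w" by linarith
      also have "\<dots> = ?B powr q * \<mu>" unfolding mass by (simp add: algebra_simps)
      finally have "(?PK + half_powr p w) / p \<le> ?B powr q * \<mu> / p"
        using p by (intro divide_right_mono) auto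
      moreover have "0 \<le> \<theta> * \<mu> powr \<gamma>" using \<theta>_pos by simp
      then have "E \<le> 0" using E_le by linarith
      moreover have "E = T / 2 - (?PK + half_powr p w) / p"
        unfolding E_eq half_energy_def T_def by (simp add: add_divide_distrib algebra_simps)
      ultimately show "T / 2 \<le> ?B powr q * \<mu> / p" by linarith
    qed
    \<comment> \<open>The quantity that is to vanish; the value at \<open>att G\<close> and the
      oscillation over the core are controlled by small multiples of it.\<close>
    define X where "X = s\<^sup>2 * Mass + Kinetic"
    have X0: "0 \<le> X" using Mass_nonneg Kinetic_nonneg by (simp add: X_def)
    have X_le: "X \<le> s\<^sup>2 * \<mu> * (1 + t0)"
    proof -
      have "s\<^sup>2 * Mass \<le> s\<^sup>2 * \<mu>" using Mass_le by (intro mult_left_mono) auto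
      moreover have "Kinetic \<le> t0 * (s\<^sup>2 * \<mu>)" using T(1) T_le s2\<mu> by simp
      ultimately show ?thesis by (simp add: X_def algebra_simps)
    qed
    have d: "s * ?d \<le> \<epsilon>" using diam by (simp add: s_def)
    have l: "0 < ?l" unfolding core_length_def using finite_edges edges_nonempty len_pos by (intro sum_pos) auto
    have sl: "1 / ?l \<le> \<epsilon> * s" using length l s by (simp add: s_def[symmetric] field_simps)
    have sdT: "s * ?d * Kinetic \<le> \<epsilon> * X"
      using d Kinetic_nonneg Mass_nonneg \<epsilon> by (intro mult_mono) (auto simp: X_def)
    \<comment> \<open>In \<open>core_length_mult_att_sq_le\<close> the length hypothesis turns Mass
      / ?l into at most \<epsilon> * s * Mass, and the diameter hypothesis bounds s * ?d * Kinetic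
      by \<epsilon> * Kinetic: both terms become multiples of \<epsilon> * X.\<close>
    have \<delta>: "s * ?\<delta>\<^sup>2 \<le> 16 * \<epsilon> * X"
    proof -
      have "?\<delta>\<^sup>2 \<le> 2 * Mass * (1 / ?l) + 16 * ?d * Kinetic"
        using core_length_mult_att_sq_le l by (simp add: field_simps)
      also have "2 * Mass * (1 / ?l) \<le> 2 * Mass * (\<epsilon> * s)"
        using sl Mass_nonneg by (intro mult_left_mono) auto
      finally have "s * ?\<delta>\<^sup>2 \<le> s * (2 * Mass * (\<epsilon> * s) + 16 * ?d * Kinetic)"
        using s by (intro mult_left_mono) auto
      also have "\<dots> = 2 * \<epsilon> * (s\<^sup>2 * Mass) + 16 * (s * ?d * Kinetic)"
        by (simp add: algebra_simps power2_eq_square)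
      also have "16 * (s * ?d * Kinetic) \<le> 16 * (\<epsilon> * Kinetic)"
        using d Kinetic_nonneg by (intro mult_left_mono mult_right_mono) auto
      also have "2 * \<epsilon> * (s\<^sup>2 * Mass) + 16 * (\<epsilon> * Kinetic) \<le> 16 * \<epsilon> * X"
        using \<epsilon> Mass_nonneg by (simp add: X_def algebra_simps)
      finally show ?thesis by simp
    qed
    have \<delta>s: "?\<delta>\<^sup>2 / s \<le> \<mu>"
    proof -
      have "s * ?\<delta>\<^sup>2 \<le> 16 * \<epsilon> * (s\<^sup>2 * \<mu> * (1 + t0))"
        using \<epsilon> by (intro order_trans[OF \<delta>] mult_left_mono X_le) auto
      also have "\<dots> = (16 * \<epsilon> * (1 + t0)) * (s\<^sup>2 * \<mu>)" by simp
      also have "\<dots> \<le> 1 * (s\<^sup>2 * \<mu>)" using \<epsilon>_le(1) \<mu> by (intro mult_right_mono) auto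
      finally show ?thesis using s by (simp add: field_simps power2_eq_square)
    qed
    have PK_le: "?PK / p \<le> \<theta> / 2 * (s\<^sup>2 * Mass)"
    proof -
      have "?PK \<le> (\<eta> * (s * \<mu>)) powr q * Mass"
        unfolding q_def
      proof (rule core_powr_integral_le[OF p(1)])
        fix e x assume "e \<in> edges G" "0 \<le> x" "x \<le> len G e"
        then have "(u e x - ?\<delta>)\<^sup>2 \<le> 8 * ?d * Kinetic" by (rule core_diff_sq_le)
        moreover have "(u e x)\<^sup>2 \<le> 2 * ?\<delta>\<^sup>2 + 2 * (u e x - ?\<delta>)\<^sup>2"
          using sum_squares_ge_zero[of "u e x - 2 * ?\<delta>" 0]
          by (simp add: power2_eq_square algebra_simps)
        ultimately have "(u e x)\<^sup>2 \<le> 2 * ?\<delta>\<^sup>2 + 16 * (?d * Kinetic)" by linarith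
        then have "s * (u e x)\<^sup>2 \<le> s * (2 * ?\<delta>\<^sup>2 + 16 * (?d * Kinetic))"
          using s by (intro mult_left_mono) auto
        also have "\<dots> = 2 * (s * ?\<delta>\<^sup>2) + 16 * (s * ?d * Kinetic)" by (simp add: algebra_simps)
        \<comment> \<open>48 = 2 * 16 + 16, from the value at \<open>att G\<close> and from the
          oscillation.\<close>
        also have "\<dots> \<le> 48 * \<epsilon> * X" using \<delta> sdT by linarith
        also have "\<dots> \<le> 48 * \<epsilon> * (s\<^sup>2 * \<mu> * (1 + t0))" using X_le \<epsilon> by (intro mult_left_mono) auto
        also have "\<dots> = (48 * \<epsilon> * (1 + t0)) * (s\<^sup>2 * \<mu>)" by simp
        also have "\<dots> \<le> \<eta> * (s\<^sup>2 * \<mu>)" using \<epsilon>_le(2) \<mu> by (intro mult_right_mono) auto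
        also have "\<dots> = s * (\<eta> * (s * \<mu>))" by (simp add: power2_eq_square)
        finally show "(u e x)\<^sup>2 \<le> \<eta> * (s * \<mu>)" using s by simp
      qed
      also have "(\<eta> * (s * \<mu>)) powr q = \<eta> powr q * s\<^sup>2"
        unfolding s\<mu>[symmetric] using \<eta>(1) s \<mu> by (simp add: powr_mult)
      finally have "?PK / p \<le> \<eta> powr q * s\<^sup>2 * Mass / p" using p by (intro divide_right_mono) auto
      also have "\<dots> = \<eta> powr q / p * (s\<^sup>2 * Mass)" by simp
      finally show ?thesis unfolding \<eta>(2) .
    qed
    have "- \<theta> * (\<mu> powr \<gamma> + \<mu> powr (\<gamma> - 1) * (c\<^sub>\<gamma> * ((w 0)\<^sup>2 / s) - Mass)) - s * (w 0)\<^sup>2 / 2 \<le> half_energy p w h"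
      using \<delta>s w0 by (intro half_energy_ge[OF Hw s \<mu> Mass_nonneg mass]) simp
    also have "- \<theta> * (\<mu> powr \<gamma> + \<mu> powr (\<gamma> - 1) * (c\<^sub>\<gamma> * ((w 0)\<^sup>2 / s) - Mass)) - s * (w 0)\<^sup>2 / 2 =
       - \<theta> * \<mu> powr \<gamma> + \<theta> * (s\<^sup>2 * Mass) - D / 16 * (s * ?\<delta>\<^sup>2)"
      unfolding s2 w0 D_def using s by (simp add: field_simps power2_eq_square)
    finally have "- \<theta> * \<mu> powr \<gamma> + \<theta> * (s\<^sup>2 * Mass) - D / 16 * (s * ?\<delta>\<^sup>2) \<le> half_energy p w h" .
    moreover have "D / 16 * (s * ?\<delta>\<^sup>2) \<le> Kinetic / 4 + \<theta> / 4 * (s\<^sup>2 * Mass)"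
    proof -
      have "D / 16 * (s * ?\<delta>\<^sup>2) \<le> D / 16 * (16 * \<epsilon> * X)" using \<delta> D by (intro mult_left_mono) auto
      also have "\<dots> = \<epsilon> * D * Kinetic + \<epsilon> * D * (s\<^sup>2 * Mass)" by (simp add: X_def algebra_simps)
      also have "\<dots> \<le> 1 / 4 * Kinetic + \<theta> / 4 * (s\<^sup>2 * Mass)"
        using \<epsilon>_le(3,4) Kinetic_nonneg Mass_nonneg by (intro add_mono mult_right_mono) auto
      finally show ?thesis by simp
    qed
    \<comment> \<open>The core contributes at least Kinetic / 2 - \<theta> / 2 * s^2 * Mass, the
      half-line exceeds the level by \<theta> * s^2 * Mass minus the ramp's price, and that price is
      at most Kinetic / 4 + \<theta> / 4 * s^2 * Mass. A quarter of each term survives.\<close>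
    ultimately have "Kinetic / 4 + \<theta> / 4 * (s\<^sup>2 * Mass) \<le> 0"
      using E_le PK_le unfolding E_eq by (simp add: field_simps)
    moreover have "0 \<le> \<theta> / 4 * (s\<^sup>2 * Mass)" using \<theta>_pos Mass_nonneg by simp
    ultimately have K0: "Kinetic = 0" and "\<theta> / 4 * (s\<^sup>2 * Mass) = 0" using Kinetic_nonneg by linarith+
    then have M0: "Mass = 0" using \<theta>_pos s by simp
    have "s * ?\<delta>\<^sup>2 \<le> 0" using \<delta> by (simp add: X_def K0 M0)
    then have "?\<delta> = 0" using s by (simp add: mult_le_0_iff)
    then have "Dirichlet w h" using Hw w0 by (simp add: Dirichlet_def)
    then have "- \<theta> * \<mu> powr \<gamma> < half_energy p w h"
      by (rule Dirichlet_energy_gt) (use mass M0 \<mu> in auto)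
    then show False using E_le PK_le unfolding E_eq K0 M0 by simp
  qed
  then show ?thesis using that \<epsilon> by blast
qed

end

theorem theorem5p1:
  fixes p :: real
  assumes "2 < p" and "p < 6"
  shows "\<exists>\<epsilon>>0. \<forall>(G :: qgraph) (\<mu> :: real).
           one_halfline_graph G \<and> \<mu> > 0 \<and>
           max (\<mu> powr ((p - 2) / (6 - p)) * core_diam G)
               (1 / (\<mu> powr ((p - 2) / (6 - p)) * core_length G)) < \<epsilon>
           \<longrightarrow> \<not> has_ground_state p G \<mu>"
proof -
  interpret subcritical p by unfold_locales (use assms in auto)
  obtain \<epsilon> where "0 < \<epsilon>"
    "\<And>G \<mu>. one_halfline_graph G \<Longrightarrow> 0 < \<mu> \<Longrightarrow> \<mu> powr \<beta> * core_diam G < \<epsilon> \<Longrightarrow>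
      1 / (\<mu> powr \<beta> * core_length G) < \<epsilon> \<Longrightarrow> \<not> has_ground_state p G \<mu>"
    using no_ground_state by blast
  then show ?thesis unfolding \<beta>_def by (intro exI[of _ \<epsilon>]) auto
qed

end
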